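(* Let $f\geq 3$ and $\alpha\in\mathrm{GF}(2^f)$ be such that $\Gamma=\Gamma(f,\alpha)=\mathrm{Cos}(G,L,Lg_\alpha L)$ is connected, and let $A=G\times\langle\sigma\rangle$, $A^+=T^2\rtimes\langle\sigma\pi\rangle$, $G=T^2\rtimes\langle\pi\rangle$, $M=T^2\times\langle\sigma\rangle$ and $G^+=T^2$. Then: (1) $\Gamma$ has girth at least $10$. (2) $\Gamma$ is $(A,3)$-arc transitive but not $(A,4)$-arc transitive. (3) $\Gamma$ is locally $(A^+,3)$-arc transitive but not locally $(A^+,4)$-arc transitive. (4) $\Gamma$ is $(G,2)$-arc transitive but not $(G,3)$-arc transitive. (5) $\Gamma$ is $(M,2)$-arc transitive but not $(M,3)$-arc transitive. (6) $\Gamma$ is locally $(G^+,2)$-arc transitive but not locally $(G^+,3)$-arc transitive.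
   Context: Let $T=\mathrm{PSL}(2,2^f)$, viewed as the group of permutations $t_{p,q,r,s}:x\mapsto \frac{px+q}{rx+s}$ of $\mathrm{GF}(2^f)\cup\{\infty\}$ with $p,q,r,s\in\mathrm{GF}(2^f)$, $ps-qr\neq0$ (usual conventions for $\infty$). Permutations act on the right, and $x^y=y^{-1}xy$. Put $a=t_{1,1,1,0}$, $b=t_{1,1,0,1}$ (so $\langle a,b\rangle=\mathrm{PSL}(2,2)\cong S_3$) and $u_\alpha=t_{1,\alpha,0,1}$ for $\alpha\in\mathrm{GF}(2^f)$. Let $G=T^2\rtimes\langle\pi\rangle$, where $\pi$ has order $2$ and $(x,y)^\pi=(y,x)$ for $(x,y)\in T^2$; let $L=\langle(a,a),(b,b)\rangle<T^2$ and $g_\alpha=(u_\alpha,bu_\alpha)\pi\in G$; then $Lg_\alpha L=Lg_\alpha^{-1}L$. For a group $X$, subgroup $Y$ and $g\in X$ with $YgY=Yg^{-1}Y$, the coset graph $\mathrm{Cos}(X,Y,YgY)$ has as vertices the right cosets of $Y$ in $X$, with $Yx_1,Yx_2$ adjacent iff $x_2x_1^{-1}\in YgY$. $G$ acts faithfully on $\Gamma(f,\alpha)=\mathrm{Cos}(G,L,Lg_\alpha L)$ by right multiplication and is regarded as a subgroup of $\mathrm{Aut}(\Gamma)$. The map $\sigma:Lx\mapsto L\pi x$ ($x\in G$) is an automorphism of $\Gamma$ of order $2$ centralising $G$ and not in $G$, so all the groups above are subgroups of $\mathrm{Aut}(\Gamma)$. An $s$-arc is an $(s+1)$-tuple $(v_0,\dots,v_s)$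 of vertices with consecutive vertices adjacent and $v_{j-1}\ne v_{j+1}$ for $1\le j\le s-1$. For $X\le\mathrm{Aut}(\Gamma)$, $\Gamma$ is $(X,s)$-arc transitive if it has an $s$-arc and $X$ is transitive on the set of $i$-arcs for each $1\le i\le s$; it is locally $(X,s)$-arc transitive if it has an $s$-arc and, for every vertex $v$ and each $1\le i\le s$, the stabiliser $X_v$ is transitive on the set of $i$-arcs with initial vertex $v$. *)

theory Defs
  imports
    "HOL-Algebra.Coset"
    "HOL-Algebra.Generated_Groups"
    "HOL-Library.Cardinality"
    "HOL-Library.Extended_Nat"
    "Graph_Theory.Graph_Theory"
begin

text \<open>A simple graph is a \<^typ>\<open>'v pair_pre_digraph\<close> whose arc set is symmetric and irreflexive;
  it is used as a digraph via \<^const>\<open>with_proj\<close>.\<close>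

text \<open>In a symmetric digraph the back-and-forth walk along an edge is a \<^const>\<open>pre_digraph.cycle\<close>
  of length 2; the bound 3 leaves exactly the cycles of the underlying simple graph.
  The girth of a forest is infinite.\<close>

definition girth :: "'v pair_pre_digraph \<Rightarrow> enat" where
  "girth \<Gamma> = (INF p \<in> {p. pre_digraph.cycle (with_proj \<Gamma>) p \<and> 3 \<le> length p}. enat (length p))"

text \<open>Automorphisms are taken extensional, so that they can be compared as permutations of the
  vertex set. The product \<open>\<phi> \<otimes> \<psi>\<close> means first \<open>\<phi>\<close>, then \<open>\<psi>\<close> (permutations act on the right).\<close>

definition Aut :: "'v pair_pre_digraph \<Rightarrow> ('v \<Rightarrow> 'v) monoid" where
  "Aut \<Gamma> = \<lparr>carrier = {\<phi> \<in> extensional (pverts \<Gamma>). bij_betw \<phi> (pverts \<Gamma>) (pverts \<Gamma>) \<and>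
                (\<forall>u\<in>pverts \<Gamma>. \<forall>v\<in>pverts \<Gamma>. (\<phi> u, \<phi> v) \<in> parcs \<Gamma> \<longleftrightarrow> (u, v) \<in> parcs \<Gamma>)},
            monoid.mult = (\<lambda>\<phi> \<psi>. compose (pverts \<Gamma>) \<psi> \<phi>),
            one = (\<lambda>v\<in>pverts \<Gamma>. v)\<rparr>"

definition sarcs :: "'v pair_pre_digraph \<Rightarrow> nat \<Rightarrow> 'v list set" where
  "sarcs \<Gamma> s = {p. length p = Suc s \<and> set p \<subseteq> pverts \<Gamma> \<and>
                  (\<forall>j<s. (p ! j, p ! Suc j) \<in> parcs \<Gamma>) \<and>
                  (\<forall>j. 1 \<le> j \<and> j < s \<longrightarrow> p ! (j - 1) \<noteq> p ! (j + 1))}"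

definition arc_transitive :: "'v pair_pre_digraph \<Rightarrow> ('v \<Rightarrow> 'v) set \<Rightarrow> nat \<Rightarrow> bool" where
  "arc_transitive \<Gamma> X s \<longleftrightarrow> sarcs \<Gamma> s \<noteq> {} \<and>
     (\<forall>i\<in>{1..s}. \<forall>p\<in>sarcs \<Gamma> i. \<forall>q\<in>sarcs \<Gamma> i. \<exists>\<phi>\<in>X. map \<phi> p = q)"

definition locally_arc_transitive :: "'v pair_pre_digraph \<Rightarrow> ('v \<Rightarrow> 'v) set \<Rightarrow> nat \<Rightarrow> bool" where
  "locally_arc_transitive \<Gamma> X s \<longleftrightarrow> sarcs \<Gamma> s \<noteq> {} \<and>
     (\<forall>v\<in>pverts \<Gamma>. \<forall>i\<in>{1..s}. \<forall>p\<in>sarcs \<Gamma> i. \<forall>q\<in>sarcs \<Gamma> i.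
        hd p = v \<and> hd q = v \<longrightarrow> (\<exists>\<phi>\<in>{\<phi>\<in>X. \<phi> v = v}. map \<phi> p = q))"

text \<open>\<open>D\<close> is meant to be a double coset \<open>YgY\<close> with \<open>YgY = Yg\<^sup>-\<^sup>1Y\<close>, which makes the arc relation
  symmetric.\<close>

definition coset_graph :: "'g monoid \<Rightarrow> 'g set \<Rightarrow> 'g set \<Rightarrow> 'g set pair_pre_digraph" where
  "coset_graph X Y D = \<lparr>pverts = rcosets\<^bsub>X\<^esub> Y,
     parcs = {(Y #>\<^bsub>X\<^esub> x\<^sub>1, Y #>\<^bsub>X\<^esub> x\<^sub>2) | x\<^sub>1 x\<^sub>2.
       x\<^sub>1 \<in> carrier X \<and> x\<^sub>2 \<in> carrier X \<and> x\<^sub>2 \<otimes>\<^bsub>X\<^esub> inv\<^bsub>X\<^esub> x\<^sub>1 \<in> D}\<rparr>"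

definition double_coset :: "'g monoid \<Rightarrow> 'g set \<Rightarrow> 'g \<Rightarrow> 'g set" where
  "double_coset X Y g = (Y #>\<^bsub>X\<^esub> g) <#>\<^bsub>X\<^esub> Y"

text \<open>Projective line over \<open>'a\<close>: \<^const>\<open>None\<close> is the point at infinity.\<close>

definition mob :: "'a::field \<Rightarrow> 'a \<Rightarrow> 'a \<Rightarrow> 'a \<Rightarrow> 'a option \<Rightarrow> 'a option" where
  "mob p q r s z = (case z of
       None \<Rightarrow> if r = 0 then None else Some (p / r)
     | Some x \<Rightarrow> if r * x + s = 0 then None else Some ((p * x + q) / (r * x + s)))"

text \<open>The group of all fractional linear maps; for \<open>'a = GF(2\<^sup>f)\<close> it is \<open>PSL(2,2\<^sup>f)\<close>, as every
  element of the field is a square. The product \<open>x \<otimes> y\<close> means first \<open>x\<close>, then \<open>y\<close>.\<close>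

definition T :: "('a::field option \<Rightarrow> 'a option) monoid" where
  "T = \<lparr>carrier = {mob p q r s | p q r s. p * s - q * r \<noteq> 0},
        monoid.mult = (\<lambda>x y. y \<circ> x), one = id\<rparr>"

definition ta :: "'a::field option \<Rightarrow> 'a option" where "ta = mob 1 1 1 0"
definition tb :: "'a::field option \<Rightarrow> 'a option" where "tb = mob 1 1 0 1"
definition tu :: "'a::field \<Rightarrow> 'a option \<Rightarrow> 'a option" where "tu \<alpha> = mob 1 \<alpha> 0 1"

type_synonym 'a elt = "(('a option \<Rightarrow> 'a option) \<times> ('a option \<Rightarrow> 'a option)) \<times> bool"

text \<open>The pair \<open>(n, e)\<close> stands for \<open>n\<pi>\<^sup>e\<close>. Since \<open>\<pi>\<^sup>2 = 1\<close>, the multiplication rule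
  is \<open>n\<pi> \<cdot> m\<pi>\<^sup>d = n m\<^sup>\<pi> \<pi>\<pi>\<^sup>d\<close>, where \<open>m\<^sup>\<pi>\<close> is \<open>m\<close> with its components swapped.\<close>

definition G :: "'a::field elt monoid" where
  "G = \<lparr>carrier = carrier (T \<times>\<times> T) \<times> UNIV,
        monoid.mult = (\<lambda>(n, e) (m, d). (n \<otimes>\<^bsub>T \<times>\<times> T\<^esub> (if e then prod.swap m else m), e \<noteq> d)),
        one = (\<one>\<^bsub>T \<times>\<times> T\<^esub>, False)\<rparr>"

definition pi_elt :: "'a::field elt" where "pi_elt = (\<one>\<^bsub>T \<times>\<times> T\<^esub>, True)"

text \<open>\<open>T\<^sup>2\<close> as a subgroup of \<open>G\<close>.\<close>

definition Tsq :: "'a::field elt set" where "Tsq = carrier (T \<times>\<times> T) \<times> {False}"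

definition L :: "'a::field elt set" where
  "L = generate G {((ta, ta), False), ((tb, tb), False)}"

definition g_elt :: "'a::field \<Rightarrow> 'a elt" where
  "g_elt \<alpha> = ((tu \<alpha>, tb \<otimes>\<^bsub>T\<^esub> tu \<alpha>), False) \<otimes>\<^bsub>G\<^esub> pi_elt"

definition Gam :: "'a::field \<Rightarrow> 'a elt set pair_pre_digraph" where
  "Gam \<alpha> = coset_graph G L (double_coset G L (g_elt \<alpha>))"

definition rmul :: "'a::field elt \<Rightarrow> 'a elt set \<Rightarrow> 'a elt set" where
  "rmul x = (\<lambda>v \<in> rcosets\<^bsub>G\<^esub> L. v #>\<^bsub>G\<^esub> x)"

text \<open>The coset \<open>L\<pi>x\<close> does not depend on the representative \<open>x\<close> of \<open>v\<close>, because \<open>\<pi>\<close>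
  centralises \<open>L\<close>.\<close>

definition sig :: "'a::field elt set \<Rightarrow> 'a elt set" where
  "sig = (\<lambda>v \<in> rcosets\<^bsub>G\<^esub> L. the_elem ((\<lambda>x. L #>\<^bsub>G\<^esub> (pi_elt \<otimes>\<^bsub>G\<^esub> x)) ` v))"

text \<open>The subgroups of \<open>Aut \<Gamma>\<close> under consideration. The direct and semidirect products are
  internal ones, hence product sets; \<open>\<langle>x\<rangle>\<close> is \<^term>\<open>generate (Aut \<Gamma>) {x}\<close>.\<close>

definition grpG :: "('a::field elt set \<Rightarrow> 'a elt set) set" where
  "grpG = rmul ` carrier G"

definition grpGplus :: "('a::field elt set \<Rightarrow> 'a elt set) set" where
  "grpGplus = rmul ` Tsq"

definition grpA :: "'a::field \<Rightarrow> ('a elt set \<Rightarrow> 'a elt set) set" where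
  "grpA \<alpha> = grpG <#>\<^bsub>Aut (Gam \<alpha>)\<^esub> generate (Aut (Gam \<alpha>)) {sig}"

definition grpAplus :: "'a::field \<Rightarrow> ('a elt set \<Rightarrow> 'a elt set) set" where
  "grpAplus \<alpha> = grpGplus <#>\<^bsub>Aut (Gam \<alpha>)\<^esub>
     generate (Aut (Gam \<alpha>)) {sig \<otimes>\<^bsub>Aut (Gam \<alpha>)\<^esub> rmul pi_elt}"

definition grpM :: "'a::field \<Rightarrow> ('a elt set \<Rightarrow> 'a elt set) set" where
  "grpM \<alpha> = grpGplus <#>\<^bsub>Aut (Gam \<alpha>)\<^esub> generate (Aut (Gam \<alpha>)) {sig}"

end

theory Submission
  imports Defs "HOL-Computational_Algebra.Polynomial" "HOL-Number_Theory.Residues"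
begin

text \<open>
  In \<open>G\<close> one has \<open>a\<^sup>3 = b\<^sup>2 = 1\<close>, \<open>a\<^sup>b = a\<^sup>-\<^sup>1\<close>, \<open>g\<^sup>2 = b\<close> and \<open>L \<inter> L\<^sup>g = \<langle>b\<rangle>\<close>, so that every
  \<open>s\<close>-arc (\<open>s \<ge> 1\<close>) of \<open>\<Gamma>\<close> has the form
  \<open>(Lh, Lgh, Lga\<^sup>\<plusminus>\<^sup>1gh, Lga\<^sup>\<plusminus>\<^sup>1ga\<^sup>\<plusminus>\<^sup>1gh, \<dots>)\<close>. For \<open>s \<ge> 2\<close> the pair consisting of the sign sequence and
  \<open>h\<close> is determined up to negating all signs and replacing \<open>h\<close> by \<open>bh\<close>. Right multiplication acts on
  \<open>h\<close> alone, while \<open>g\<^sup>\<pi> = bg\<close> implies that \<open>\<sigma>\<close> replaces \<open>h\<close> by \<open>\<pi>h\<close> and negates every other sign,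
  beginning with the first. All claims on arc-transitivity can be read off from this; for the
  subgroups not containing \<open>\<pi>\<close> one keeps track of the coset of \<open>T\<^sup>2\<close> that contains \<open>h\<close>.

  A cycle of length \<open>n\<close> yields a word \<open>a\<^sup>\<plusminus>\<^sup>1g \<dots> a\<^sup>\<plusminus>\<^sup>1g\<close> with \<open>n\<close> factors \<open>g\<close> lying in \<open>{1, b}\<close>, and \<open>n\<close>
  is even. The first component of such a word is a matrix with entries in \<open>GF(2)[\<alpha>]\<close>; for
  \<open>n \<in> {4, 6, 8}\<close> a computation of greatest common divisors in \<open>GF(2)[x]\<close> shows that it lies in
  \<open>{1, b}\<close> only if \<open>\<alpha> \<in> GF(4)\<close>, that is, \<open>\<alpha>\<^sup>4 = \<alpha>\<close>. In that case, however, all elements of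
  \<open>\<langle>L, g\<rangle>\<close> commute with \<open>x \<mapsto> x\<^sup>4\<close>, which contradicts connectedness as \<open>f \<ge> 3\<close>.
\<close>

section \<open>Arcs and cycles\<close>

lemma sarcs_Cons:
  assumes "p \<in> sarcs \<Gamma> s"
  shows "u # p \<in> sarcs \<Gamma> (Suc s) \<longleftrightarrow>
    u \<in> pverts \<Gamma> \<and> (u, hd p) \<in> parcs \<Gamma> \<and> (1 \<le> s \<longrightarrow> u \<noteq> p ! 1)"
proof -
  have p: "length p = Suc s" "set p \<subseteq> pverts \<Gamma>" "\<And>j. j < s \<Longrightarrow> (p ! j, p ! Suc j) \<in> parcs \<Gamma>"
    "\<And>j. 1 \<le> j \<Longrightarrow> j < s \<Longrightarrow> p ! (j - 1) \<noteq> p ! (j + 1)"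
    using assms by (auto simp: sarcs_def)
  have h: "hd p = p ! 0" using p(1) by (metis Zero_not_Suc hd_conv_nth list.size(3))
  have "(\<forall>j<Suc s. ((u # p) ! j, (u # p) ! Suc j) \<in> parcs \<Gamma>) \<longleftrightarrow> (u, hd p) \<in> parcs \<Gamma>"
    using p(3) by (auto simp: less_Suc_eq_0_disj h)
  moreover have "(\<forall>j. 1 \<le> j \<and> j < Suc s \<longrightarrow> (u # p) ! (j - 1) \<noteq> (u # p) ! (j + 1)) \<longleftrightarrow> (1 \<le> s \<longrightarrow> u \<noteq> p ! 1)"
    (is "?l \<longleftrightarrow> ?r")
  proof
    assume r: ?r
    show ?l
    proof (intro allI impI)
      fix j assume j: "1 \<le> j \<and> j < Suc s"
      show "(u # p) ! (j - 1) \<noteq> (u # p) ! (j + 1)"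
      proof (cases "j = 1")
        case False
        then show ?thesis using p(4)[of "j - 1"] j by (cases j) auto
      qed (use r j in auto)
    qed
  next
    assume ?l
    from spec[OF this, of 1] show ?r by auto
  qed
  ultimately show ?thesis
    using p(1,2) by (auto simp: sarcs_def)
qed

lemma sarcs_ConsD:
  assumes "u # p \<in> sarcs \<Gamma> (Suc s)"
  shows "p \<in> sarcs \<Gamma> s"
proof -
  have *: "length p = Suc s" "set p \<subseteq> pverts \<Gamma>"
      "\<And>j. j < Suc s \<Longrightarrow> ((u # p) ! j, (u # p) ! Suc j) \<in> parcs \<Gamma>"
      "\<And>j. 1 \<le> j \<Longrightarrow> j < Suc s \<Longrightarrow> (u # p) ! (j - 1) \<noteq> (u # p) ! (j + 1)"
    using assms by (auto simp: sarcs_def)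
  have "p ! (j - 1) \<noteq> p ! (j + 1)" if "1 \<le> j" "j < s" for j
    using *(4)[of "Suc j"] that by (cases j) auto
  with * show ?thesis by (force simp: sarcs_def)
qed

lemma cas_with_proj:
  "pre_digraph.cas (with_proj \<Gamma>) u p v \<Longrightarrow> i < length p \<Longrightarrow>
    fst (p ! i) = (if i = 0 then u else snd (p ! (i - 1))) \<and> snd (last p) = v"
proof (induction p arbitrary: u i)
  case (Cons e p)
  then have c: "fst e = u" "pre_digraph.cas (with_proj \<Gamma>) (snd e) p v"
    by (simp_all add: pre_digraph.cas.simps)
  show ?case
  proof (cases p)
    case Nil
    then show ?thesis using c Cons.prems by (simp add: pre_digraph.cas.simps)
  next
    case (Cons e' p')
    show ?thesis
    proof (cases i)
      case 0
      then show ?thesis using Cons.IH[OF c(2), of 0] c Cons by simp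
    next
      case (Suc k)
      then show ?thesis using Cons.IH[OF c(2), of k] Cons.prems Cons by (cases k) auto
    qed
  qed
qed simp

text \<open>The cycle is traversed once and then along its first arc again. Returning to an arc, not
  merely to a vertex, later leaves only the ambiguity \<open>{\<one>, b}\<close>.\<close>

lemma cycle_sarc:
  assumes "pre_digraph.cycle (with_proj \<Gamma>) p" "3 \<le> length p"
    and wf: "parcs \<Gamma> \<subseteq> pverts \<Gamma> \<times> pverts \<Gamma>"
  obtains q where "q \<in> sarcs \<Gamma> (Suc (length p))" "q ! length p = q ! 0" "q ! Suc (length p) = q ! 1"
proof -
  let ?n = "length p"
  obtain u where u: "pre_digraph.awalk (with_proj \<Gamma>) u p u"
    "distinct (tl (pre_digraph.awalk_verts (with_proj \<Gamma>) u p))"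
    using assms(1) by (auto simp: pre_digraph.cycle_def)
  then have cas: "pre_digraph.cas (with_proj \<Gamma>) u p u" and arcs: "set p \<subseteq> parcs \<Gamma>"
    by (auto simp: pre_digraph.awalk_def)
  have dist: "distinct (map snd p)"
    using u(2) assms(2) by (auto simp: pre_digraph.awalk_verts_conv'[OF cas] split: if_splits)
  \<comment> \<open>Modulo n this is i - 1, so that \<open>w 0\<close>, the head of the last arc, is
    the base vertex \<open>u\<close>.\<close>
  define k where "k i = (i + ?n - 1) mod ?n" for i
  define w where "w i = snd (p ! k i)" for i
  have n: "?n > 0" using assms(2) by linarith
  have k: "k i < ?n" for i using n by (simp add: k_def)
  have k_Suc: "k (Suc i) = (if k i = ?n - 1 then 0 else Suc (k i))" for i
  proof -
    have "k (Suc i) = Suc (k i) mod ?n"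
      using n by (simp add: k_def mod_Suc_eq)
    then show ?thesis using k[of i] n by auto
  qed
  have w_arc: "(w i, w (Suc i)) \<in> parcs \<Gamma>" for i
  proof -
    have "fst (p ! k (Suc i)) = w i"
      using cas_with_proj[OF cas k[of "Suc i"]] n k[of i]
      by (auto simp: k_Suc w_def last_conv_nth split: if_splits)
    then have "(w i, w (Suc i)) = p ! k (Suc i)" by (simp add: w_def prod_eq_iff)
    then show ?thesis using arcs k nth_mem by (metis subsetD)
  qed
  have w_ne: "w i \<noteq> w (Suc (Suc i))" for i
  proof -
    have "k i \<noteq> k (Suc (Suc i))" using assms(2) k[of i] by (auto simp: k_Suc)
    then show ?thesis using dist k[of i] k[of "Suc (Suc i)"] by (auto simp: w_def distinct_conv_nth)
  qed
  have "map w [0..<?n + 2] \<in> sarcs \<Gamma> (Suc ?n)"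
  proof -
    have nth: "map w [0..<?n + 2] ! j = w j" if "j < ?n + 2" for j
      using that by (simp del: upt_Suc)
    have "w j \<in> pverts \<Gamma>" for j using w_arc[of j] wf by auto
    moreover have "w (j - 1) \<noteq> w (j + 1)" if "1 \<le> j" for j
      using w_ne[of "j - 1"] that by simp
    ultimately show ?thesis using w_arc by (auto simp: sarcs_def nth simp del: upt_Suc)
  qed
  moreover have "w ?n = w 0" "w (Suc ?n) = w 1"
  proof -
    have "?n + ?n - 1 = (?n - 1) + ?n" using n by simp
    then have "k ?n = k 0" unfolding k_def by (metis add_0 mod_add_self2)
    then show "w ?n = w 0" by (simp add: w_def)
    show "w (Suc ?n) = w 1" by (simp add: w_def k_def)
  qed
  ultimately show ?thesis
    using n assms(2) by (intro that[of "map w [0..<?n + 2]"]) (auto simp del: upt_Suc)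
qed

section \<open>Coset graphs of amalgams with vertex group \<open>S\<^sub>3\<close>\<close>

text \<open>The relations between the generators in abstract form. Degenerate cases are excluded by
  \<open>g_a\<close>: if a were 1 or b, its conjugate would lie in the vertex group.\<close>

locale s3_amalgam = group X for X :: "'g monoid" (structure) +
  fixes a b g
  assumes closed [simp]: "a \<in> carrier X" "b \<in> carrier X" "g \<in> carrier X"
    and a3: "a \<otimes> (a \<otimes> a) = \<one>"
    and b2: "b \<otimes> b = \<one>"
    and b_a: "b \<otimes> a = a \<otimes> (a \<otimes> b)"
    and g2: "g \<otimes> g = b"
    and g_a: "g \<otimes> (a \<otimes> inv g) \<notin> generate X {a, b}"
begin

section \<open>Normal forms in the vertex group, a copy of S_3\<close>

abbreviation "Y \<equiv> generate X {a, b}"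

definition rot where "rot e = (if e then a else a \<otimes> a)"

lemma rot_closed [simp]: "rot e \<in> carrier X"
  by (simp add: rot_def)

lemma subgroup_Y: "subgroup Y X"
  by (simp add: generate_is_subgroup)

lemma Y_closed [simp]: "y \<in> Y \<Longrightarrow> y \<in> carrier X"
  by (rule subgroup.mem_carrier[OF subgroup_Y])

lemma gens_in_Y [simp]: "a \<in> Y" "b \<in> Y" "\<one> \<in> Y" "rot e \<in> Y"
proof -
  show *: "a \<in> Y" "b \<in> Y" "\<one> \<in> Y" by (auto intro: generate.intros)
  show "rot e \<in> Y" using * by (auto simp: rot_def intro: generate.intros)
qed

lemma Y_mult [simp]: "x \<in> Y \<Longrightarrow> y \<in> Y \<Longrightarrow> x \<otimes> y \<in> Y"
  and Y_inv [simp]: "x \<in> Y \<Longrightarrow> inv x \<in> Y"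
  by (simp_all add: subgroup.m_closed[OF subgroup_Y] subgroup.m_inv_closed[OF subgroup_Y])

lemma inv_b [simp]: "inv b = b"
  using b2 by (simp add: inv_equality)

lemma inv_rot [simp]: "inv (rot e) = rot (\<not> e)"
  using a3 by (auto simp: rot_def m_assoc intro!: inv_equality)

text \<open>Each relation is restated with an arbitrary factor on the right, so that it applies
  inside right-nested products. Rewriting with \<open>rot_b\<close> and \<open>g_b\<close> collects
  the factors b on the left.\<close>

lemma b2_left: "x \<in> carrier X \<Longrightarrow> b \<otimes> (b \<otimes> x) = x"
  by (simp add: b2 flip: m_assoc)

lemma b_a_left: "x \<in> carrier X \<Longrightarrow> b \<otimes> (a \<otimes> x) = a \<otimes> (a \<otimes> (b \<otimes> x))"
  using b_a by (metis closed(1,2) m_assoc m_closed)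

lemma a3_left: "x \<in> carrier X \<Longrightarrow> a \<otimes> (a \<otimes> (a \<otimes> x)) = x"
  using a3 by (metis closed(1) l_one m_assoc m_closed)

lemma b_rot: "x \<in> carrier X \<Longrightarrow> b \<otimes> (rot e \<otimes> x) = rot (\<not> e) \<otimes> (b \<otimes> x)"
  by (auto simp: rot_def m_assoc b_a_left a3_left)

lemma rot_b: "x \<in> carrier X \<Longrightarrow> rot e \<otimes> (b \<otimes> x) = b \<otimes> (rot (\<not> e) \<otimes> x)"
  by (simp add: b_rot)

lemma g2_left: "x \<in> carrier X \<Longrightarrow> g \<otimes> (g \<otimes> x) = b \<otimes> x"
  by (simp flip: g2 m_assoc)

lemma g_b: "x \<in> carrier X \<Longrightarrow> g \<otimes> (b \<otimes> x) = b \<otimes> (g \<otimes> x)"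
  by (simp flip: g2_left)

lemma rot_rot: "x \<in> carrier X \<Longrightarrow> rot e \<otimes> (rot e' \<otimes> x) = (if e = e' then rot (\<not> e) \<otimes> x else x)"
  by (auto simp: rot_def m_assoc a3_left)

lemma inv_g: "inv g = b \<otimes> g"
  by (rule inv_equality) (simp_all add: m_assoc g2 b2)

text \<open>The listed products contain 1 and are stable under left multiplication by the generators
  and their inverses. The induction quantifies over the right factor so that the case of a product
  composes.\<close>

lemma Y_cases:
  assumes "y \<in> Y"
  obtains i where "i \<in> {\<one>, b}" "y = i"
    | i e where "i \<in> {\<one>, b}" "y = i \<otimes> rot e"
proof -
  define S where "S = {\<one>, b} \<union> {i \<otimes> rot e | i e. i \<in> {\<one>, b}}"
  have SI: "\<one> \<in> S" "b \<in> S" "rot e \<in> S" "b \<otimes> rot e \<in> S" for e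
    unfolding S_def by auto (metis l_one rot_closed)
  have S_closed: "S \<subseteq> carrier X" by (auto simp: S_def)
  have b_S: "b \<otimes> x \<in> S" if "x \<in> S" for x
  proof -
    from that consider "x = \<one>" | "x = b" | e where "x = rot e" | e where "x = b \<otimes> rot e"
      by (auto simp: S_def)
    then show ?thesis
      by cases (use SI in \<open>simp_all add: b2 b2_left\<close>)
  qed
  have r_S: "rot e \<otimes> x \<in> S" if "x \<in> S" for x e
  proof -
    from that consider "x = \<one>" | "x = b" | e' where "x = rot e'" | e' where "x = b \<otimes> rot e'"
      by (auto simp: S_def)
    then show ?thesis
    proof cases
      case 2
      then show ?thesis using SI rot_b[of \<one> e] by simp
    next
      case 3
      then show ?thesis using SI rot_rot[of \<one> e] by simp
    next
      case 4
      then show ?thesis using SI rot_rot[of \<one> "\<not> e"] by (simp add: rot_b b2)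
    qed (use SI in simp)
  qed
  have "x \<in> Y \<Longrightarrow> (\<forall>y\<in>S. x \<otimes> y \<in> S)" for x
  proof (induction rule: generate.induct)
    case one
    then show ?case using S_closed by auto
  next
    case (incl h)
    then show ?case using b_S r_S[of _ True] by (auto simp: rot_def)
  next
    case (inv h)
    then show ?case using b_S r_S[of _ False] inv_rot[of True] by (auto simp: rot_def)
  next
    case (eng h1 h2)
    then show ?case using S_closed by (auto simp: m_assoc subset_iff)
  qed
  from this[OF assms] have "y \<in> S" using SI(1) assms by force
  then show ?thesis using that by (auto simp: S_def)
qed

text \<open>If g a^e g lies in Y for one sign e, then so does g a^-e g^-1 = b g a^e g, and also its
  square g a^e g^-1. One of these two conjugates contradicts \<open>g_a\<close>.\<close>

lemma g_rot_g_notin: "g \<otimes> (rot e \<otimes> g) \<notin> Y"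
proof
  assume 1: "g \<otimes> (rot e \<otimes> g) \<in> Y"
  have "g \<otimes> (rot e \<otimes> inv g) = b \<otimes> (g \<otimes> (rot (\<not> e) \<otimes> g))" for e
    by (simp add: inv_g rot_b g_b)
  then have 2: "g \<otimes> (rot (\<not> e) \<otimes> inv g) \<in> Y"
    using 1 by simp
  have "(g \<otimes> (rot (\<not> e) \<otimes> inv g)) \<otimes> (g \<otimes> (rot (\<not> e) \<otimes> inv g)) = g \<otimes> (rot e \<otimes> inv g)"
    by (simp add: inv_g m_assoc rot_b g_b g2_left g2 b2_left rot_rot)
  then have "g \<otimes> (rot True \<otimes> inv g) \<in> Y"
    using 2 Y_mult[OF 2 2] by (cases e) auto
  then show False using g_a by (simp add: rot_def)
qed

lemma rot_notin: "rot e \<notin> {\<one>, b}"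
proof
  assume "rot e \<in> {\<one>, b}"
  then consider "rot e = \<one>" | "rot e = b" by blast
  then show False using g_rot_g_notin[of e] by cases (simp_all add: g2 g_b b2)
qed

text \<open>This computes the stabiliser of the arc (Y, Yg). For y = i a^e with i in {1, b} the
  conjugate is i b g a^-e g, which \<open>g_rot_g_notin\<close> excludes.\<close>

lemma inter_conj_Y:
  assumes "y \<in> Y" "g \<otimes> (y \<otimes> inv g) \<in> Y"
  shows "y \<in> {\<one>, b}"
  using assms(1)
proof (cases rule: Y_cases)
  case (2 i e)
  then have "g \<otimes> (y \<otimes> inv g) = i \<otimes> (b \<otimes> (g \<otimes> (rot (\<not> e) \<otimes> g)))"
    by (auto simp: inv_g m_assoc rot_b g_b)
  moreover have "i \<in> Y" using 2 by auto
  ultimately have "g \<otimes> (rot (\<not> e) \<otimes> g) \<in> Y"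
    using assms(2) 2 by (auto dest: Y_mult[OF gens_in_Y(2)] simp: b2_left)
  then show ?thesis using g_rot_g_notin by blast
qed auto

section \<open>Cosets and adjacency\<close>

lemma coset_eq_iff:
  assumes "x \<in> carrier X" "y \<in> carrier X"
  shows "Y #> x = Y #> y \<longleftrightarrow> (\<exists>k\<in>Y. y = k \<otimes> x)"
proof
  assume "Y #> x = Y #> y"
  then have "y \<in> Y #> x" using assms rcos_self subgroup_Y by blast
  then show "\<exists>k\<in>Y. y = k \<otimes> x" by (auto simp: r_coset_def)
next
  assume "\<exists>k\<in>Y. y = k \<otimes> x"
  then have "y \<in> Y #> x" by (auto simp: r_coset_def)
  then show "Y #> x = Y #> y" using assms subgroup_Y repr_independence by blast
qed

lemma coset_eqI: "k \<in> Y \<Longrightarrow> x \<in> carrier X \<Longrightarrow> Y #> (k \<otimes> x) = Y #> x"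
  by (subst eq_commute, subst coset_eq_iff) auto

abbreviation "\<Gamma> \<equiv> coset_graph X Y (double_coset X Y g)"

lemma in_double_coset: "x \<in> double_coset X Y g \<longleftrightarrow> (\<exists>k\<in>Y. \<exists>l\<in>Y. x = k \<otimes> (g \<otimes> l))"
  by (auto simp: double_coset_def r_coset_def set_mult_def m_assoc; metis Y_closed closed(3) m_assoc)

lemma pverts: "pverts \<Gamma> = (\<lambda>x. Y #> x) ` carrier X"
  by (auto simp: coset_graph_def RCOSETS_def)

text \<open>Of an element of YgY, the left factor disappears in the coset, and the right one takes
  up the change of representative.\<close>

lemma parcs_iff:
  assumes "x \<in> carrier X"
  shows "(Y #> x, v) \<in> parcs \<Gamma> \<longleftrightarrow> (\<exists>l\<in>Y. v = Y #> (g \<otimes> (l \<otimes> x)))"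
proof
  assume "(Y #> x, v) \<in> parcs \<Gamma>"
  then obtain x1 x2 where 1: "Y #> x = Y #> x1" "v = Y #> x2" "x1 \<in> carrier X" "x2 \<in> carrier X"
    "x2 \<otimes> inv x1 \<in> double_coset X Y g"
    by (auto simp: coset_graph_def)
  obtain k where k: "k \<in> Y" "x1 = k \<otimes> x" using 1 assms by (auto simp: coset_eq_iff)
  obtain l l' where l: "l \<in> Y" "l' \<in> Y" "x2 \<otimes> inv x1 = l \<otimes> (g \<otimes> l')"
    using 1 by (auto simp: in_double_coset)
  then have "x2 = l \<otimes> (g \<otimes> ((l' \<otimes> k) \<otimes> x))"
    using 1 k assms by (metis (no_types, lifting) Y_closed closed(3) inv_solve_right' m_assoc m_closed)
  then show "\<exists>l\<in>Y. v = Y #> (g \<otimes> (l \<otimes> x))"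
    using 1 k l assms by (intro bexI[of _ "l' \<otimes> k"]) (auto simp: coset_eqI)
next
  assume "\<exists>l\<in>Y. v = Y #> (g \<otimes> (l \<otimes> x))"
  then obtain l where l: "l \<in> Y" "v = Y #> (g \<otimes> (l \<otimes> x))" by blast
  have "g \<otimes> (l \<otimes> x) \<otimes> inv x = \<one> \<otimes> (g \<otimes> l)" using l assms by (simp add: m_assoc)
  moreover have "\<one> \<otimes> (g \<otimes> l) \<in> double_coset X Y g"
    unfolding in_double_coset using l gens_in_Y by blast
  ultimately show "(Y #> x, v) \<in> parcs \<Gamma>"
    using l assms unfolding coset_graph_def
    by (simp del: l_one) (metis Y_closed closed(3) m_closed)
qed

lemma parcs_subset: "parcs \<Gamma> \<subseteq> pverts \<Gamma> \<times> pverts \<Gamma>"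
  by (auto simp: coset_graph_def intro: rcosetsI)

section \<open>Arcs as sign sequences\<close>

fun walk where
  "walk [] h = [Y #> h]"
| "walk (e # es) h = (Y #> h) # walk es (g \<otimes> (rot e \<otimes> h))"

text \<open>The first arc carries no sign, since a suitable representative h of the initial vertex
  turns any neighbour into Ygh. The signs thus record only the choices between the two continuations
  that do not turn back; s signs give an (s + 1)-arc.\<close>

definition path where "path es h = (Y #> h) # walk es (g \<otimes> h)"

lemma length_walk [simp]: "length (walk es h) = Suc (length es)"
  by (induction es arbitrary: h) auto

lemma hd_walk [simp]: "hd (walk es h) = Y #> h"
  by (cases es) auto

lemma walk_nth_0 [simp]: "walk es h ! 0 = Y #> h"
  by (cases es) auto

lemma walk_b: "h \<in> carrier X \<Longrightarrow> walk es (b \<otimes> h) = walk (map Not es) h"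
  by (induction es arbitrary: h) (auto simp: coset_eqI rot_b g_b)

lemma path_b: "h \<in> carrier X \<Longrightarrow> path es (b \<otimes> h) = path (map Not es) h"
  by (auto simp: path_def coset_eqI g_b walk_b)

text \<open>Turning back would put g a^e g into Y for some sign e.\<close>

lemma walk_in_sarcs: "h \<in> carrier X \<Longrightarrow> walk es h \<in> sarcs \<Gamma> (length es)"
proof (induction es arbitrary: h)
  case Nil
  then show ?case by (auto simp: sarcs_def pverts)
next
  case (Cons e es)
  let ?h = "g \<otimes> (rot e \<otimes> h)"
  have "Y #> h \<noteq> walk es ?h ! 1" if len: "1 \<le> length es"
  proof
    assume eq: "Y #> h = walk es ?h ! 1"
    obtain e' es' where "es = e' # es'" using len by (cases es) auto
    with eq have "Y #> h = Y #> (g \<otimes> (rot e' \<otimes> ?h))"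
      by simp
    then have "Y #> (rot e \<otimes> h) = Y #> (g \<otimes> (rot e' \<otimes> ?h))"
      using Cons.prems by (simp add: coset_eqI)
    then obtain k where k: "k \<in> Y" "g \<otimes> (rot e' \<otimes> ?h) = k \<otimes> (rot e \<otimes> h)"
      using Cons.prems by (auto simp: coset_eq_iff)
    then have "(g \<otimes> (rot e' \<otimes> g)) \<otimes> (rot e \<otimes> h) = k \<otimes> (rot e \<otimes> h)"
      using Cons.prems by (simp add: m_assoc)
    then have "g \<otimes> (rot e' \<otimes> g) = k"
      using Cons.prems k(1) by (metis Y_closed closed(3) m_closed right_cancel rot_closed)
    with k(1) show False using g_rot_g_notin[of e'] by metis
  qed
  moreover have "(Y #> h, Y #> ?h) \<in> parcs \<Gamma>"
    using Cons.prems by (subst parcs_iff) auto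
  ultimately show ?case
    using Cons by (subst walk.simps, subst list.size(4), simp only: add_0_right add_Suc_right)
      (subst sarcs_Cons, auto simp: pverts)
qed

lemma path_in_sarcs:
  assumes "h \<in> carrier X"
  shows "path es h \<in> sarcs \<Gamma> (Suc (length es))"
proof -
  \<comment> \<open>The first sign contributes a, which cancels the a^-1 in the base element, so
    this walk is the path in question.\<close>
  have "walk (True # es) (rot False \<otimes> h) \<in> sarcs \<Gamma> (length (True # es))"
    using assms by (intro walk_in_sarcs) auto
  then show ?thesis using assms by (auto simp: path_def rot_rot coset_eqI)
qed

text \<open>The vertices adjacent to Ygh are Yglgh with l in Y. If l is 1 or b, this is Yh again;
  otherwise l is a^e up to a left factor 1 or b, which moves past g into the coset.\<close>

lemma sarc_is_walk:
  assumes "h \<in> carrier X" "(Y #> h) # (Y #> (g \<otimes> h)) # p \<in> sarcs \<Gamma> s"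
  obtains es where "(Y #> (g \<otimes> h)) # p = walk es (g \<otimes> h)"
proof -
  from assms have "\<exists>es. (Y #> (g \<otimes> h)) # p = walk es (g \<otimes> h)"
  proof (induction p arbitrary: h s)
    case Nil
    then show ?case by (intro exI[of _ "[]"]) auto
  next
    case (Cons w p)
    let ?v = "Y #> (g \<otimes> h)"
    from Cons.prems obtain s' where s: "s = Suc (Suc s')" by (auto simp: sarcs_def)
    from Cons.prems(2) have "?v # w # p \<in> sarcs \<Gamma> (Suc s')"
      unfolding s by (rule sarcs_ConsD)
    moreover from Cons.prems have "(?v, w) \<in> parcs \<Gamma>" "w \<noteq> Y #> h"
      by (auto simp: sarcs_def s dest: spec[of _ 1])
    moreover obtain l where l: "l \<in> Y" "w = Y #> (g \<otimes> (l \<otimes> (g \<otimes> h)))"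
      using calculation(2) Cons.prems by (auto simp: parcs_iff)
    have "\<exists>e. w = Y #> (g \<otimes> (rot e \<otimes> (g \<otimes> h)))"
      using l(1)
    proof (cases rule: Y_cases)
      case (1 i)
      then have "w = Y #> h" using l Cons.prems by (auto simp: g2_left g_b coset_eqI)
      with \<open>w \<noteq> Y #> h\<close> show ?thesis by simp
    next
      case (2 i e)
      then show ?thesis using l Cons.prems by (intro exI[of _ e]) (auto simp: m_assoc g_b coset_eqI)
    qed
    then obtain e where e: "w = Y #> (g \<otimes> (rot e \<otimes> (g \<otimes> h)))" by blast
    \<comment> \<open>With the representative a^e g h of \<open>?v\<close>, the next arc has the
      form required by the induction hypothesis.\<close>
    have "?v = Y #> (rot e \<otimes> (g \<otimes> h))" using Cons.prems by (simp add: coset_eqI)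
    with Cons.IH[of "rot e \<otimes> (g \<otimes> h)" "Suc s'"] calculation(1) Cons.prems e
    obtain es where "w # p = walk es (g \<otimes> (rot e \<otimes> (g \<otimes> h)))" by auto
    then show ?case by (intro exI[of _ "e # es"]) auto
  qed
  with that show ?thesis by blast
qed

lemma sarcs_cases:
  assumes "p \<in> sarcs \<Gamma> (Suc s)"
  obtains es h where "length es = s" "h \<in> carrier X" "p = path es h"
proof -
  from assms obtain u v q where p: "p = u # v # q" "length q = s"
    by (auto simp: sarcs_def length_Suc_conv)
  then have "u \<in> pverts \<Gamma>" "(u, v) \<in> parcs \<Gamma>" using assms by (auto simp: sarcs_def)
  then obtain x l where x: "x \<in> carrier X" "u = Y #> x" "l \<in> Y" "v = Y #> (g \<otimes> (l \<otimes> x))"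
    by (auto simp: pverts parcs_iff)
  then have u: "u = Y #> (l \<otimes> x)" "l \<otimes> x \<in> carrier X" by (auto simp: coset_eqI)
  obtain es where es: "v # q = walk es (g \<otimes> (l \<otimes> x))"
    using sarc_is_walk[OF u(2)] assms p u x by metis
  then have "length es = s" using p(2) by (metis length_walk length_Cons nat.inject)
  with es u p show ?thesis by (intro that[of es "l \<otimes> x"]) (auto simp: path_def)
qed

text \<open>Two base elements of the same arc differ by an element of an arc stabiliser, which
  \<open>inter_conj_Y\<close> determines.\<close>

lemma hd_cases:
  assumes "h \<in> carrier X" "h' \<in> carrier X" "Y #> h = Y #> h'" "Y #> (g \<otimes> h) = Y #> (g \<otimes> h')"
  shows "h' = h \<or> h' = b \<otimes> h"
proof -
  obtain k where k: "k \<in> Y" "h' = k \<otimes> h" using assms by (auto simp: coset_eq_iff)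
  obtain l where l: "l \<in> Y" "g \<otimes> (k \<otimes> h) = l \<otimes> (g \<otimes> h)" using assms k by (auto simp: coset_eq_iff)
  have "(g \<otimes> k) \<otimes> h = (l \<otimes> g) \<otimes> h" using l k assms by (simp add: m_assoc)
  then have "g \<otimes> k = l \<otimes> g" using l k assms by (metis Y_closed closed(3) m_closed right_cancel)
  then have "g \<otimes> (k \<otimes> inv g) = l" using l k by (metis Y_closed closed(3) inv_closed inv_solve_right' m_assoc m_closed)
  then have "k \<in> {\<one>, b}" using k l inter_conj_Y by blast
  then show ?thesis using k assms by auto
qed

text \<open>The first arcs are compared by \<open>hd_cases\<close>. If their signs differed, then
  a^e' = a^e a^e would force a^e into {1, b}.\<close>

lemma walk_inj:
  "h \<in> carrier X \<Longrightarrow> length es = length es' \<Longrightarrow> walk es h = walk es' h \<Longrightarrow> es = es'"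
proof (induction es es' arbitrary: h rule: list_induct2')
  case (4 e es e' es')
  let ?h = "g \<otimes> (rot e \<otimes> h)" and ?h' = "g \<otimes> (rot e' \<otimes> h)"
  have eq: "walk es ?h = walk es' ?h'" using 4 by simp
  have "Y #> ?h = Y #> ?h'" using arg_cong[OF eq, of hd] by simp
  moreover have "Y #> (rot e \<otimes> h) = Y #> (rot e' \<otimes> h)" using 4 by (simp add: coset_eqI)
  ultimately have or: "rot e' \<otimes> h = rot e \<otimes> h \<or> rot e' \<otimes> h = b \<otimes> (rot e \<otimes> h)"
    using hd_cases[of "rot e \<otimes> h" "rot e' \<otimes> h"] 4 by auto
  have "e = e'"
  proof (rule ccontr)
    assume ne: "e \<noteq> e'"
    let ?k = "rot e \<otimes> h"
    have k: "?k \<in> carrier X" using 4 by simp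
    have "rot e' \<otimes> h = rot e \<otimes> ?k" using ne 4 by (auto simp: rot_rot)
    with or have "rot e \<otimes> ?k = \<one> \<otimes> ?k \<or> rot e \<otimes> ?k = b \<otimes> ?k" using k by auto
    then have "rot e \<in> {\<one>, b}" using k right_cancel by auto
    then show False using rot_notin by simp
  qed
  moreover have "es = es'" using 4(1)[of ?h] 4(2,3) eq calculation by simp
  ultimately show ?case by simp
qed auto

text \<open>The common first sign \<open>e\<close> pins down the base element, because passing from
  h to bh would negate it.\<close>

lemma path_inj:
  assumes "h \<in> carrier X" "h' \<in> carrier X" "length es = length es'"
    and eq: "path (e # es) h = path (e # es') h'"
  shows "h = h'" "es = es'"
proof -
  have w: "walk (e # es) (g \<otimes> h) = walk (e # es') (g \<otimes> h')" and "Y #> h = Y #> h'"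
    using eq by (simp_all add: path_def)
  moreover have "Y #> (g \<otimes> h) = Y #> (g \<otimes> h')" using arg_cong[OF w, of hd] by simp
  ultimately have or: "h' = h \<or> h' = b \<otimes> h" using hd_cases assms by blast
  show "h = h'"
  proof (rule ccontr)
    assume "h \<noteq> h'"
    with or have "path (e # es') h' = path (map Not (e # es')) h" using path_b assms by auto
    with eq have "walk (e # es) (g \<otimes> h) = walk (map Not (e # es')) (g \<otimes> h)"
      by (simp add: path_def)
    from walk_inj[OF _ _ this] assms show False by simp
  qed
  with w have "walk (e # es) (g \<otimes> h) = walk (e # es') (g \<otimes> h)" by simp
  from walk_inj[OF _ _ this] assms show "es = es'" by simp
qed

section \<open>Words of closed paths\<close>

fun word where
  "word [] = \<one>"
| "word (e # es) = rot e \<otimes> (g \<otimes> word es)"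

lemma word_closed [simp]: "word es \<in> carrier X"
  by (induction es) auto

lemma word_snoc: "word (es @ [e]) = word es \<otimes> (rot e \<otimes> g)"
  by (induction es) (simp_all add: m_assoc)

text \<open>Each step multiplies on the left, hence the reversal of the signs.\<close>

lemma walk_nth:
  "h \<in> carrier X \<Longrightarrow> j \<le> length es \<Longrightarrow> walk es (g \<otimes> h) ! j = Y #> (g \<otimes> (word (rev (take j es)) \<otimes> h))"
proof (induction es arbitrary: j h)
  case (Cons e es)
  then show ?case
    by (cases j) (simp_all add: word_snoc m_assoc)
qed simp

text \<open>Both h and \<open>?x\<close> are base elements of the arc at which the path starts and
  ends, so \<open>hd_cases\<close> applies.\<close>

lemma closed_path_word:
  assumes h: "h \<in> carrier X"
    and "path (es @ [e]) h ! Suc (length es) = path (es @ [e]) h ! 0"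
    and "path (es @ [e]) h ! Suc (Suc (length es)) = path (es @ [e]) h ! 1"
  shows "word (e # rev es) \<in> {\<one>, b}"
proof -
  let ?x = "word (e # rev es) \<otimes> h"
  have "Y #> h = Y #> (g \<otimes> (word (rev es) \<otimes> h))" "Y #> (g \<otimes> h) = Y #> (g \<otimes> ?x)"
    using assms by (auto simp: path_def walk_nth)
  moreover have "Y #> (g \<otimes> (word (rev es) \<otimes> h)) = Y #> ?x"
    using h by (simp add: m_assoc coset_eqI)
  ultimately have "?x = \<one> \<otimes> h \<or> ?x = b \<otimes> h"
    using hd_cases[of h ?x] h by auto
  then show ?thesis using h right_cancel[of h "word (e # rev es)"] by auto
qed

lemma cycle_word:
  assumes "pre_digraph.cycle (with_proj \<Gamma>) p" "3 \<le> length p"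
  obtains es where "length es = length p" "word es \<in> {\<one>, b}"
proof -
  obtain q where q: "q \<in> sarcs \<Gamma> (Suc (length p))" "q ! length p = q ! 0" "q ! Suc (length p) = q ! 1"
    using cycle_sarc[OF assms] parcs_subset by blast
  obtain es' h where h: "length es' = length p" "h \<in> carrier X" "q = path es' h"
    using sarcs_cases[OF q(1)] by blast
  with assms(2) obtain es e where e: "es' = es @ [e]" by (cases es' rule: rev_cases) auto
  have "word (e # rev es) \<in> {\<one>, b}"
    using q h e by (intro closed_path_word[of h]) auto
  then show ?thesis using h e by (intro that[of "e # rev es"]) auto
qed

end

section \<open>Automorphisms\<close>

lemma Aut_group: "group (Aut \<Gamma>)"
proof (rule groupI)
  fix \<phi> \<psi> assume "\<phi> \<in> carrier (Aut \<Gamma>)" "\<psi> \<in> carrier (Aut \<Gamma>)"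
  then show "\<phi> \<otimes>\<^bsub>Aut \<Gamma>\<^esub> \<psi> \<in> carrier (Aut \<Gamma>)"
    by (auto simp: Aut_def bij_betw_compose compose_eq dest: bij_betwE intro: bij_betw_compose)
next
  show "\<one>\<^bsub>Aut \<Gamma>\<^esub> \<in> carrier (Aut \<Gamma>)"
    by (auto simp: Aut_def bij_betw_def inj_on_def)
next
  fix \<phi> \<psi> \<chi>
  assume "\<phi> \<in> carrier (Aut \<Gamma>)" "\<psi> \<in> carrier (Aut \<Gamma>)" "\<chi> \<in> carrier (Aut \<Gamma>)"
  then show "\<phi> \<otimes>\<^bsub>Aut \<Gamma>\<^esub> \<psi> \<otimes>\<^bsub>Aut \<Gamma>\<^esub> \<chi> = \<phi> \<otimes>\<^bsub>Aut \<Gamma>\<^esub> (\<psi> \<otimes>\<^bsub>Aut \<Gamma>\<^esub> \<chi>)"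
    by (auto simp: Aut_def fun_eq_iff compose_def dest: bij_betwE)
next
  fix \<phi> assume "\<phi> \<in> carrier (Aut \<Gamma>)"
  then show "\<one>\<^bsub>Aut \<Gamma>\<^esub> \<otimes>\<^bsub>Aut \<Gamma>\<^esub> \<phi> = \<phi>"
    by (auto simp: Aut_def fun_eq_iff compose_def extensional_def)
next
  fix \<phi> assume \<phi>: "\<phi> \<in> carrier (Aut \<Gamma>)"
  let ?V = "pverts \<Gamma>" and ?\<psi> = "restrict (inv_into (pverts \<Gamma>) \<phi>) (pverts \<Gamma>)"
  have bij: "bij_betw \<phi> ?V ?V"
    and arcs: "\<And>u v. u \<in> ?V \<Longrightarrow> v \<in> ?V \<Longrightarrow> (\<phi> u, \<phi> v) \<in> parcs \<Gamma> \<longleftrightarrow> (u, v) \<in> parcs \<Gamma>"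
    using \<phi> by (auto simp: Aut_def)
  have bij': "bij_betw (inv_into ?V \<phi>) ?V ?V" using bij by (rule bij_betw_inv_into)
  have "(inv_into ?V \<phi> u, inv_into ?V \<phi> v) \<in> parcs \<Gamma> \<longleftrightarrow> (u, v) \<in> parcs \<Gamma>" if "u \<in> ?V" "v \<in> ?V" for u v
    using arcs[of "inv_into ?V \<phi> u" "inv_into ?V \<phi> v"] that bij_betwE[OF bij']
      bij_betw_inv_into_right[OF bij] by simp
  moreover have "bij_betw ?\<psi> ?V ?V"
    using bij' by (simp cong: bij_betw_cong)
  ultimately have "?\<psi> \<in> carrier (Aut \<Gamma>)"
    by (auto simp: Aut_def)
  moreover have "?\<psi> \<otimes>\<^bsub>Aut \<Gamma>\<^esub> \<phi> = \<one>\<^bsub>Aut \<Gamma>\<^esub>"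
    using bij bij' by (auto simp: Aut_def fun_eq_iff compose_def bij_betw_inv_into_right dest: bij_betwE)
  ultimately show "\<exists>\<psi>\<in>carrier (Aut \<Gamma>). \<psi> \<otimes>\<^bsub>Aut \<Gamma>\<^esub> \<phi> = \<one>\<^bsub>Aut \<Gamma>\<^esub>" by blast
qed

lemma (in group) generate_involution:
  assumes "x \<in> carrier G" "x \<otimes> x = \<one>"
  shows "generate G {x} = {\<one>, x}"
proof
  have inv: "inv x = x" using assms by (simp add: inv_equality)
  show "generate G {x} \<subseteq> {\<one>, x}"
  proof
    fix y assume "y \<in> generate G {x}"
    then show "y \<in> {\<one>, x}"
      by (induction rule: generate.induct) (use assms inv in auto)
  qed
qed (auto intro: generate.intros)

fun alt :: "bool \<Rightarrow> bool list \<Rightarrow> bool list" where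
  "alt c [] = []"
| "alt c (e # es) = (e \<noteq> c) # alt (\<not> c) es"

text \<open>Here \<open>p\<close> stands for \<pi> and \<open>N\<close> for T^2. By
  \<open>p \<notin> N\<close> and \<open>N_index\<close> the subgroup has index 2, so membership in
  it is a parity, which \<open>N_mult\<close> lets the simplifier compute.\<close>

locale s3_amalgam_swap = s3_amalgam +
  fixes p N
  assumes p [simp]: "p \<in> carrier X" and p2: "p \<otimes> p = \<one>"
    and p_a: "p \<otimes> a = a \<otimes> p" and p_b: "p \<otimes> b = b \<otimes> p" and p_g: "p \<otimes> g = b \<otimes> (g \<otimes> p)"
    and N: "subgroup N X" "a \<in> N" "b \<in> N" "g \<notin> N" "p \<notin> N"
    and N_index: "x \<in> carrier X \<Longrightarrow> y \<in> carrier X \<Longrightarrow> x \<notin> N \<Longrightarrow> y \<notin> N \<Longrightarrow> x \<otimes> y \<in> N"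
begin

lemma N_closed: "x \<in> N \<Longrightarrow> x \<in> carrier X"
  by (rule subgroup.mem_carrier[OF N(1)])

lemma N_inv [simp]: "x \<in> carrier X \<Longrightarrow> inv x \<in> N \<longleftrightarrow> x \<in> N"
  by (metis N(1) inv_inv subgroup.m_inv_closed)

lemma N_mult [simp]:
  assumes "x \<in> carrier X" "y \<in> carrier X"
  shows "x \<otimes> y \<in> N \<longleftrightarrow> (x \<in> N \<longleftrightarrow> y \<in> N)"
proof -
  have 1: "y \<in> N" if "x \<in> N" "x \<otimes> y \<in> N"
  proof -
    have "inv x \<otimes> (x \<otimes> y) \<in> N" using that N(1) by (simp add: subgroup.m_closed subgroup.m_inv_closed)
    then show ?thesis using assms by (simp add: flip: m_assoc)
  qed
  have 2: "x \<in> N" if "y \<in> N" "x \<otimes> y \<in> N"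
  proof -
    have "(x \<otimes> y) \<otimes> inv y \<in> N" using that N(1) by (simp add: subgroup.m_closed subgroup.m_inv_closed)
    then show ?thesis using assms by (simp add: m_assoc)
  qed
  show ?thesis
    using 1 2 N_index[OF assms] subgroup.m_closed[OF N(1)] by blast
qed

lemma Y_N [simp]: "y \<in> Y \<Longrightarrow> y \<in> N"
  using generate_subgroup_incl[of "{a, b}" N] N by auto

lemma N_simps [simp]: "g \<notin> N" "p \<notin> N" "b \<in> N"
  by (simp_all add: N)

lemma p2_left: "x \<in> carrier X \<Longrightarrow> p \<otimes> (p \<otimes> x) = x"
  by (simp add: p2 flip: m_assoc)

lemma p_b_left: "x \<in> carrier X \<Longrightarrow> p \<otimes> (b \<otimes> x) = b \<otimes> (p \<otimes> x)"
  using p_b by (metis closed(2) m_assoc p)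

lemma p_a_left: "x \<in> carrier X \<Longrightarrow> p \<otimes> (a \<otimes> x) = a \<otimes> (p \<otimes> x)"
  using p_a by (metis closed(1) m_assoc p)

lemma p_rot: "x \<in> carrier X \<Longrightarrow> p \<otimes> (rot e \<otimes> x) = rot e \<otimes> (p \<otimes> x)"
  by (simp add: rot_def m_assoc p_a_left)

lemma p_g_left: "x \<in> carrier X \<Longrightarrow> p \<otimes> (g \<otimes> x) = b \<otimes> (g \<otimes> (p \<otimes> x))"
  using p_g by (metis closed(2,3) m_assoc m_closed p)

lemma inv_p [simp]: "inv p = p"
  using p2 by (simp add: inv_equality)

lemma p_Y:
  assumes "y \<in> Y" "x \<in> carrier X"
  shows "p \<otimes> (y \<otimes> x) = y \<otimes> (p \<otimes> x)"
  using assms(1) by (cases rule: Y_cases) (use assms(2) in \<open>auto simp: m_assoc p_b_left p_rot\<close>)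

section \<open>The automorphisms and their action on paths\<close>

definition shift where "shift x = (\<lambda>v \<in> rcosets Y. v #> x)"

definition sg where
  "sg = (\<lambda>v \<in> rcosets Y. the_elem ((\<lambda>x. Y #> (p \<otimes> x)) ` v))"

text \<open>These become \<open>G\<close>, \<open>G\<^sup>+\<close>, \<open>A\<close>, \<open>M\<close> and \<open>A\<^sup>+\<close>, in this order.\<close>

definition "grp_G = shift ` carrier X"
definition "grp_N = shift ` N"
definition "grp_A = grp_G <#>\<^bsub>Aut \<Gamma>\<^esub> generate (Aut \<Gamma>) {sg}"
definition "grp_M = grp_N <#>\<^bsub>Aut \<Gamma>\<^esub> generate (Aut \<Gamma>) {sg}"
definition "grp_P = grp_N <#>\<^bsub>Aut \<Gamma>\<^esub> generate (Aut \<Gamma>) {sg \<otimes>\<^bsub>Aut \<Gamma>\<^esub> shift p}"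

lemma coset_in_rcosets [simp]: "h \<in> carrier X \<Longrightarrow> Y #> h \<in> rcosets Y"
  by (simp add: rcosetsI subset_iff)

lemma pverts_eq: "pverts \<Gamma> = rcosets Y"
  by (simp add: coset_graph_def)

lemma rcosetsE':
  assumes "v \<in> rcosets Y"
  obtains h where "h \<in> carrier X" "v = Y #> h"
  using assms by (auto simp: RCOSETS_def)

lemma shift_coset [simp]:
  "h \<in> carrier X \<Longrightarrow> x \<in> carrier X \<Longrightarrow> shift x (Y #> h) = Y #> (h \<otimes> x)"
  by (simp add: shift_def coset_mult_assoc subset_iff)

lemma sg_coset [simp]:
  assumes "h \<in> carrier X"
  shows "sg (Y #> h) = Y #> (p \<otimes> h)"
proof -
  have "(\<lambda>x. Y #> (p \<otimes> x)) ` (Y #> h) = {Y #> (p \<otimes> h)}"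
  proof -
    have "Y #> (p \<otimes> x) = Y #> (p \<otimes> h)" if "x \<in> Y #> h" for x
      using that assms by (auto simp: r_coset_def[of _ Y h] p_Y coset_eqI)
    then show ?thesis using rcos_self[OF assms subgroup_Y] by blast
  qed
  then show ?thesis using assms by (simp add: sg_def)
qed

text \<open>Adjacency is reflected by \<open>\<phi>\<close> because the inverse
  \<open>\<psi>\<close> preserves arcs too.\<close>

lemma AutI:
  assumes "\<phi> \<in> extensional (pverts \<Gamma>)"
    and "\<And>v. v \<in> pverts \<Gamma> \<Longrightarrow> \<phi> v \<in> pverts \<Gamma>" "\<And>v. v \<in> pverts \<Gamma> \<Longrightarrow> \<psi> v \<in> pverts \<Gamma>"
    and "\<And>v. v \<in> pverts \<Gamma> \<Longrightarrow> \<psi> (\<phi> v) = v" "\<And>v. v \<in> pverts \<Gamma> \<Longrightarrow> \<phi> (\<psi> v) = v"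
    and "\<And>u v. (u, v) \<in> parcs \<Gamma> \<Longrightarrow> (\<phi> u, \<phi> v) \<in> parcs \<Gamma>"
    and "\<And>u v. (u, v) \<in> parcs \<Gamma> \<Longrightarrow> (\<psi> u, \<psi> v) \<in> parcs \<Gamma>"
  shows "\<phi> \<in> carrier (Aut \<Gamma>)"
proof -
  have "bij_betw \<phi> (pverts \<Gamma>) (pverts \<Gamma>)"
    by (rule bij_betw_byWitness[of _ \<psi>]) (use assms in auto)
  then show ?thesis using assms unfolding Aut_def by simp metis
qed

lemma shift_arc:
  assumes "(u, v) \<in> parcs \<Gamma>" "x \<in> carrier X"
  shows "(shift x u, shift x v) \<in> parcs \<Gamma>"
proof -
  obtain h where h: "h \<in> carrier X" "u = Y #> h"
    using assms parcs_subset by (auto simp: pverts)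
  then obtain l where "l \<in> Y" "v = Y #> (g \<otimes> (l \<otimes> h))" using assms by (auto simp: parcs_iff)
  then show ?thesis using h assms by (auto simp: parcs_iff m_assoc)
qed

lemma sg_arc:
  assumes "(u, v) \<in> parcs \<Gamma>"
  shows "(sg u, sg v) \<in> parcs \<Gamma>"
proof -
  obtain h where h: "h \<in> carrier X" "u = Y #> h"
    using assms parcs_subset by (auto simp: pverts)
  then obtain l where "l \<in> Y" "v = Y #> (g \<otimes> (l \<otimes> h))" using assms by (auto simp: parcs_iff)
  then show ?thesis using h assms by (auto simp: parcs_iff p_g_left p_Y coset_eqI)
qed

lemma shift_Aut: "x \<in> carrier X \<Longrightarrow> shift x \<in> carrier (Aut \<Gamma>)"
  by (rule AutI[of _ "shift (inv x)"])
    (auto simp: shift_arc pverts_eq m_assoc elim!: rcosetsE', simp add: shift_def)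

lemma sg_Aut: "sg \<in> carrier (Aut \<Gamma>)"
  by (rule AutI[of _ sg])
    (auto simp: sg_arc pverts_eq p2_left elim!: rcosetsE', simp add: sg_def)

lemma Aut_mult: "\<phi> \<otimes>\<^bsub>Aut \<Gamma>\<^esub> \<psi> = (\<lambda>v \<in> rcosets Y. \<psi> (\<phi> v))"
  by (simp add: Aut_def compose_def pverts_eq)

lemma Aut_one: "\<one>\<^bsub>Aut \<Gamma>\<^esub> = (\<lambda>v \<in> rcosets Y. v)"
  by (simp add: Aut_def pverts_eq)

lemma generate_sg: "generate (Aut \<Gamma>) {sg} = {\<one>\<^bsub>Aut \<Gamma>\<^esub>, sg}"
  by (rule group.generate_involution[OF Aut_group sg_Aut])
    (auto simp: Aut_mult Aut_one fun_eq_iff p2_left elim!: rcosetsE')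

lemma generate_sg_shift:
  "generate (Aut \<Gamma>) {sg \<otimes>\<^bsub>Aut \<Gamma>\<^esub> shift p} = {\<one>\<^bsub>Aut \<Gamma>\<^esub>, sg \<otimes>\<^bsub>Aut \<Gamma>\<^esub> shift p}"
proof (rule group.generate_involution[OF Aut_group])
  show "sg \<otimes>\<^bsub>Aut \<Gamma>\<^esub> shift p \<in> carrier (Aut \<Gamma>)"
    by (simp add: group.is_monoid Aut_group monoid.m_closed sg_Aut shift_Aut)
qed (auto simp: Aut_mult Aut_one fun_eq_iff p2_left m_assoc p2 elim!: rcosetsE')

lemma set_path: "h \<in> carrier X \<Longrightarrow> set (path es h) \<subseteq> rcosets Y"
  using path_in_sarcs[of h es] by (auto simp: sarcs_def pverts_eq)

lemma map_shift_walk: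
  "h \<in> carrier X \<Longrightarrow> x \<in> carrier X \<Longrightarrow> map (shift x) (walk es h) = walk es (h \<otimes> x)"
  by (induction es arbitrary: h) (auto simp: m_assoc)

lemma map_shift_path:
  "h \<in> carrier X \<Longrightarrow> x \<in> carrier X \<Longrightarrow> map (shift x) (path es h) = path es (h \<otimes> x)"
  by (simp add: path_def map_shift_walk m_assoc)

text \<open>The flag \<open>c\<close> tells whether a factor b is pending. Since p g = b g p, moving
  p past g creates such a factor or cancels the pending one; while pending, it negates the next
  sign.\<close>

lemma map_sg_walk:
  "h \<in> carrier X \<Longrightarrow> k \<in> carrier X \<Longrightarrow> p \<otimes> h = (if c then b \<otimes> k else k) \<Longrightarrow>
    map sg (walk es h) = walk (alt c es) k"
proof (induction es arbitrary: c h k)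
  case (Cons e es)
  have "p \<otimes> (g \<otimes> (rot e \<otimes> h)) = (if \<not> c then b \<otimes> (g \<otimes> (rot (e \<noteq> c) \<otimes> k)) else g \<otimes> (rot (e \<noteq> c) \<otimes> k))"
    using Cons.prems by (auto simp: p_g_left p_rot rot_b g_b b2_left)
  from Cons.IH[OF _ _ this] Cons.prems show ?case by (auto simp: coset_eqI)
qed (auto simp: coset_eqI)

lemma map_sg_path:
  "h \<in> carrier X \<Longrightarrow> map sg (path es h) = path (alt True es) (p \<otimes> h)"
  \<comment> \<open>The flag starts as \<open>True\<close> because the unsigned first step has
    already produced one b.\<close>
  using map_sg_walk[of "g \<otimes> h" "g \<otimes> (p \<otimes> h)" True es] by (simp add: path_def p_g_left)

lemma map_Aut_mult:
  "h \<in> carrier X \<Longrightarrow> map (\<phi> \<otimes>\<^bsub>Aut \<Gamma>\<^esub> \<psi>) (path es h) = map \<psi> (map \<phi> (path es h))"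
  using set_path[of h es] by (auto simp: Aut_mult)

lemma shift_mult_one: "x \<in> carrier X \<Longrightarrow> shift x \<otimes>\<^bsub>Aut \<Gamma>\<^esub> \<one>\<^bsub>Aut \<Gamma>\<^esub> = shift x"
  by (simp add: group.is_monoid Aut_group monoid.r_one shift_Aut)

lemma grp_A_eq: "grp_A = shift ` carrier X \<union> (\<lambda>x. shift x \<otimes>\<^bsub>Aut \<Gamma>\<^esub> sg) ` carrier X"
  by (auto simp: grp_A_def grp_G_def generate_sg set_mult_def shift_mult_one)

lemma grp_M_eq: "grp_M = shift ` N \<union> (\<lambda>x. shift x \<otimes>\<^bsub>Aut \<Gamma>\<^esub> sg) ` N"
  by (auto simp: grp_M_def grp_N_def generate_sg set_mult_def shift_mult_one N_closed)

lemma grp_P_eq: "grp_P = shift ` N \<union> (\<lambda>x. shift x \<otimes>\<^bsub>Aut \<Gamma>\<^esub> (sg \<otimes>\<^bsub>Aut \<Gamma>\<^esub> shift p)) ` N"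
  by (auto simp: grp_P_def grp_N_def generate_sg_shift set_mult_def shift_mult_one N_closed)

lemma map_shift_sg_path:
  "h \<in> carrier X \<Longrightarrow> x \<in> carrier X \<Longrightarrow>
    map (shift x \<otimes>\<^bsub>Aut \<Gamma>\<^esub> sg) (path es h) = path (alt True es) (p \<otimes> (h \<otimes> x))"
  by (simp only: map_Aut_mult map_shift_path map_sg_path m_closed)

lemma map_shift_sg_shift_path:
  "h \<in> carrier X \<Longrightarrow> x \<in> carrier X \<Longrightarrow>
    map (shift x \<otimes>\<^bsub>Aut \<Gamma>\<^esub> (sg \<otimes>\<^bsub>Aut \<Gamma>\<^esub> shift p)) (path es h) = path (alt True es) (p \<otimes> (h \<otimes> (x \<otimes> p)))"
  by (simp only: map_Aut_mult map_shift_path map_sg_path m_closed p m_assoc)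

section \<open>Transitivity of the five groups\<close>

lemma arc_transitiveI:
  assumes "0 < s" "\<And>es es' h h'. length es < s \<Longrightarrow> length es' = length es \<Longrightarrow>
      h \<in> carrier X \<Longrightarrow> h' \<in> carrier X \<Longrightarrow> \<exists>\<phi>\<in>S. map \<phi> (path es h) = path es' h'"
  shows "arc_transitive \<Gamma> S s"
  unfolding arc_transitive_def
proof (intro conjI ballI)
  show "sarcs \<Gamma> s \<noteq> {}"
    using path_in_sarcs[of \<one> "replicate (s - 1) True"] assms(1) by auto
next
  fix i q q' assume i: "i \<in> {1..s}" and "q \<in> sarcs \<Gamma> i" "q' \<in> sarcs \<Gamma> i"
  then have "q \<in> sarcs \<Gamma> (Suc (i - 1))" "q' \<in> sarcs \<Gamma> (Suc (i - 1))" by auto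
  then obtain es h es' h' where "length es = i - 1" "h \<in> carrier X" "q = path es h"
    "length es' = i - 1" "h' \<in> carrier X" "q' = path es' h'"
    using sarcs_cases by metis
  then show "\<exists>\<phi>\<in>S. map \<phi> q = q'" using assms(2)[of es es' h h'] i by auto
qed

text \<open>Arcs with the same initial vertex have base elements in the same coset of Y, hence of
  equal parity, as Y lies in N. A map taking one arc to the other fixes that vertex
  automatically.\<close>

lemma locally_arc_transitiveI:
  assumes "0 < s" "\<And>es es' h h'. length es < s \<Longrightarrow> length es' = length es \<Longrightarrow>
      h \<in> carrier X \<Longrightarrow> h' \<in> carrier X \<Longrightarrow> h \<in> N \<longleftrightarrow> h' \<in> N \<Longrightarrow>
      \<exists>\<phi>\<in>S. map \<phi> (path es h) = path es' h'"
  shows "locally_arc_transitive \<Gamma> S s"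
  unfolding locally_arc_transitive_def
proof (intro conjI ballI impI)
  show "sarcs \<Gamma> s \<noteq> {}"
    using path_in_sarcs[of \<one> "replicate (s - 1) True"] assms(1) by auto
next
  fix v i q q' assume i: "i \<in> {1..s}" and "q \<in> sarcs \<Gamma> i" "q' \<in> sarcs \<Gamma> i" and hd: "hd q = v \<and> hd q' = v"
  then have "q \<in> sarcs \<Gamma> (Suc (i - 1))" "q' \<in> sarcs \<Gamma> (Suc (i - 1))" by auto
  then obtain es h es' h' where q: "length es = i - 1" "h \<in> carrier X" "q = path es h"
    "length es' = i - 1" "h' \<in> carrier X" "q' = path es' h'"
    using sarcs_cases by metis
  have "Y #> h = Y #> h'" using hd q by (simp add: path_def)
  then obtain k where "k \<in> Y" "h' = k \<otimes> h" using q by (auto simp: coset_eq_iff)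
  then have "h \<in> N \<longleftrightarrow> h' \<in> N" using q by simp
  moreover have "i - 1 < s" using i by auto
  ultimately obtain \<phi> where \<phi>: "\<phi> \<in> S" "map \<phi> q = q'"
    using assms(2)[of es es' h h'] q by auto
  moreover have "q \<noteq> []" using q by (simp add: path_def)
  ultimately have "\<phi> v = v" using hd by (metis hd_map)
  with \<phi> show "\<exists>\<phi>\<in>{\<phi> \<in> S. \<phi> v = v}. map \<phi> q = q'" by blast
qed

text \<open>Paths based at 1 share their initial vertex, so one pair of them can refute either kind
  of transitivity.\<close>

lemma transitive_imp_map:
  assumes "arc_transitive \<Gamma> S (Suc (length es)) \<or> locally_arc_transitive \<Gamma> S (Suc (length es))"
    and "length es = length es'"
  shows "\<exists>\<phi>\<in>S. map \<phi> (path es \<one>) = path es' \<one>"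
proof -
  have s: "path es \<one> \<in> sarcs \<Gamma> (Suc (length es))" "path es' \<one> \<in> sarcs \<Gamma> (Suc (length es))"
    using path_in_sarcs[of \<one> es] path_in_sarcs[of \<one> es'] assms(2) by simp_all
  have hd: "hd (path es \<one>) = Y #> \<one> \<and> hd (path es' \<one>) = Y #> \<one>" and v: "Y #> \<one> \<in> pverts \<Gamma>"
    by (simp_all add: path_def pverts_eq)
  have i: "Suc (length es) \<in> {1..Suc (length es)}" by simp
  from assms(1) show ?thesis
  proof
    assume "arc_transitive \<Gamma> S (Suc (length es))"
    then show ?thesis unfolding arc_transitive_def using s i by blast
  next
    assume "locally_arc_transitive \<Gamma> S (Suc (length es))"
    then have "\<exists>\<phi>\<in>{\<phi> \<in> S. \<phi> (Y #> \<one>) = Y #> \<one>}. map \<phi> (path es \<one>) = path es' \<one>"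
      unfolding locally_arc_transitive_def using s i hd v by blast
    then show ?thesis by blast
  qed
qed

lemma ex_shift:
  assumes "h \<in> carrier X" "h' \<in> carrier X" "path es h' = q" "shift (inv h \<otimes> h') \<in> S"
  shows "\<exists>\<phi>\<in>S. map \<phi> (path es h) = q"
  using assms map_shift_path[of h "inv h \<otimes> h'" es]
  by (intro bexI[of _ "shift (inv h \<otimes> h')"]) (auto simp flip: m_assoc)

text \<open>Solving p h x = h' gives x = h^-1 p h', which is in N exactly if h and h' differ in
  parity. The element h^-1 p h' p of \<open>ex_shift_sg_shift\<close> is in N exactly if they agree.
  This is the difference between M and A^+.\<close>

lemma ex_shift_sg:
  assumes "h \<in> carrier X" "h' \<in> carrier X" "path (alt True es) h' = q"
    and "shift (inv h \<otimes> (p \<otimes> h')) \<otimes>\<^bsub>Aut \<Gamma>\<^esub> sg \<in> S"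
  shows "\<exists>\<phi>\<in>S. map \<phi> (path es h) = q"
proof -
  have "p \<otimes> (h \<otimes> (inv h \<otimes> (p \<otimes> h'))) = h'"
    using assms by (simp add: p2_left flip: m_assoc[of h])
  then show ?thesis
    using assms map_shift_sg_path[of h "inv h \<otimes> (p \<otimes> h')" es] by (intro bexI[OF _ assms(4)]) auto
qed

lemma ex_shift_sg_shift:
  assumes "h \<in> carrier X" "h' \<in> carrier X" "path (alt True es) h' = q"
    and "shift (inv h \<otimes> (p \<otimes> (h' \<otimes> p))) \<otimes>\<^bsub>Aut \<Gamma>\<^esub> (sg \<otimes>\<^bsub>Aut \<Gamma>\<^esub> shift p) \<in> S"
  shows "\<exists>\<phi>\<in>S. map \<phi> (path es h) = q"
proof -
  have "p \<otimes> (h \<otimes> (inv h \<otimes> (p \<otimes> (h' \<otimes> p)) \<otimes> p)) = h'"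
    using assms by (simp add: p2_left p2 m_assoc flip: m_assoc[of h "inv h"])
  then show ?thesis
    using assms map_shift_sg_shift_path[of h "inv h \<otimes> (p \<otimes> (h' \<otimes> p))" es]
    by (intro bexI[OF _ assms(4)]) auto
qed

lemma length_lt_2_cases:
  assumes "length es < 2" "length es' = length es"
  shows "es' = es \<or> es' = map Not es"
  using assms by (cases es; cases es') auto

lemma alt_eq_Not: "length es < 2 \<Longrightarrow> alt True es = map Not es"
  by (cases es) auto

text \<open>Negation and alternation together are transitive on the four sequences of two
  signs.\<close>

lemma length_lt_3_cases:
  assumes "length es < 3" "length es' = length es"
  shows "es' = es \<or> es' = map Not es \<or> es' = alt True es \<or> es' = map Not (alt True es)"
proof -
  consider "length es = 0" | "length es = 1" | "length es = 2" using assms by linarith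
  then show ?thesis using assms(2)
    by cases (auto simp: length_Suc_conv numeral_2_eq_2)
qed

lemma grp_G_2: "arc_transitive \<Gamma> grp_G 2"
proof (rule arc_transitiveI)
  fix es es' :: "bool list" and h h' assume *: "length es < 2" "length es' = length es" "h \<in> carrier X" "h' \<in> carrier X"
  from length_lt_2_cases[OF *(1,2)] show "\<exists>\<phi>\<in>grp_G. map \<phi> (path es h) = path es' h'"
  proof
    assume "es' = es"
    with * show ?thesis by (intro ex_shift[of h h']) (auto simp: grp_G_def)
  next
    assume "es' = map Not es"
    with * show ?thesis by (intro ex_shift[of h "b \<otimes> h'"]) (auto simp: grp_G_def path_b)
  qed
qed simp

lemma grp_N_2: "locally_arc_transitive \<Gamma> grp_N 2"
proof (rule locally_arc_transitiveI)
  fix es es' :: "bool list" and h h' assume *: "length es < 2" "length es' = length es" "h \<in> carrier X" "h' \<in> carrier X"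
    "h \<in> N \<longleftrightarrow> h' \<in> N"
  from length_lt_2_cases[OF *(1,2)] show "\<exists>\<phi>\<in>grp_N. map \<phi> (path es h) = path es' h'"
  proof
    assume "es' = es"
    with * show ?thesis by (intro ex_shift[of h h']) (auto simp: grp_N_def)
  next
    assume "es' = map Not es"
    with * show ?thesis by (intro ex_shift[of h "b \<otimes> h'"]) (auto simp: grp_N_def path_b)
  qed
qed simp

text \<open>On at most one sign, alternation is the same as negation, which a factor b undoes. Hence
  \<sigma> serves to reach base elements of the other parity.\<close>

lemma grp_M_2: "arc_transitive \<Gamma> grp_M 2"
proof (rule arc_transitiveI)
  fix es es' :: "bool list" and h h' assume *: "length es < 2" "length es' = length es" "h \<in> carrier X" "h' \<in> carrier X"
  from length_lt_2_cases[OF *(1,2)] show "\<exists>\<phi>\<in>grp_M. map \<phi> (path es h) = path es' h'"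
  proof
    assume "es' = es"
    with * show ?thesis
      by (cases "h \<in> N \<longleftrightarrow> h' \<in> N")
        (auto simp: grp_M_eq alt_eq_Not path_b comp_def intro: ex_shift[of h h'] ex_shift_sg[of h "b \<otimes> h'"])
  next
    assume "es' = map Not es"
    with * show ?thesis
      by (cases "h \<in> N \<longleftrightarrow> h' \<in> N")
        (auto simp: grp_M_eq alt_eq_Not path_b intro: ex_shift[of h "b \<otimes> h'"] ex_shift_sg[of h "h'"])
  qed
qed simp

lemma grp_A_3: "arc_transitive \<Gamma> grp_A 3"
proof (rule arc_transitiveI)
  fix es es' :: "bool list" and h h' assume *: "length es < 3" "length es' = length es" "h \<in> carrier X" "h' \<in> carrier X"
  show "\<exists>\<phi>\<in>grp_A. map \<phi> (path es h) = path es' h'"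
    using length_lt_3_cases[OF *(1,2)] *
    by (elim disjE) (auto simp: grp_A_eq path_b intro: ex_shift[of h h'] ex_shift[of h "b \<otimes> h'"]
      ex_shift_sg[of h h'] ex_shift_sg[of h "b \<otimes> h'"])
qed simp

lemma grp_P_3: "locally_arc_transitive \<Gamma> grp_P 3"
proof (rule locally_arc_transitiveI)
  fix es es' :: "bool list" and h h' assume *: "length es < 3" "length es' = length es" "h \<in> carrier X" "h' \<in> carrier X"
    "h \<in> N \<longleftrightarrow> h' \<in> N"
  show "\<exists>\<phi>\<in>grp_P. map \<phi> (path es h) = path es' h'"
    using length_lt_3_cases[OF *(1,2)] *
    by (elim disjE) (auto simp: grp_P_eq path_b intro: ex_shift[of h h'] ex_shift[of h "b \<otimes> h'"]
      ex_shift_sg_shift[of h h'] ex_shift_sg_shift[of h "b \<otimes> h'"])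
qed simp

lemma shift_no_map:
  assumes "x \<in> carrier X" "length es = length es'" "es \<noteq> es'"
  shows "map (shift x) (path (e # es) \<one>) \<noteq> path (e # es') \<one>"
  using path_inj(2)[of x \<one> es es' e] assms by (auto simp: map_shift_path)

text \<open>A shift keeps the signs and changes only the base element; by \<open>path_inj\<close> it
  cannot alter the second sign alone.\<close>

lemma grp_G_3: "\<not> arc_transitive \<Gamma> grp_G 3"
  and grp_N_3: "\<not> locally_arc_transitive \<Gamma> grp_N 3"
proof -
  have *: "\<not> (\<exists>\<phi>\<in>grp_G. map \<phi> (path [True, True] \<one>) = path [True, False] \<one>)"
    using shift_no_map[of _ "[True]" "[False]" True] by (auto simp: grp_G_def)
  moreover have "grp_N \<subseteq> grp_G" by (auto simp: grp_N_def grp_G_def N_closed)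
  ultimately show "\<not> arc_transitive \<Gamma> grp_G 3" "\<not> locally_arc_transitive \<Gamma> grp_N 3"
    using transitive_imp_map[of grp_G "[True, True]" "[True, False]"]
      transitive_imp_map[of grp_N "[True, True]" "[True, False]"] by (auto simp: numeral_3_eq_3)
qed

lemma path_alt_inj:
  assumes "x \<in> carrier X" "path [False, True] x = path [True, False] \<one>"
  shows "x = b"
proof -
  have "path [True, False] (b \<otimes> x) = path [True, False] \<one>" using assms by (simp add: path_b)
  then have "b \<otimes> x = \<one>" using assms path_inj(1)[of "b \<otimes> x" \<one> "[False]" "[False]" True] by simp
  then show ?thesis using assms(1) by (metis b2_left closed(2) r_one)
qed

text \<open>Altering the second sign alone requires \<sigma>, and then p x = b for some x in N. But
  p x is not in N, while b is.\<close>

lemma grp_M_3: "\<not> arc_transitive \<Gamma> grp_M 3"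
proof
  assume "arc_transitive \<Gamma> grp_M 3"
  then obtain \<phi> where \<phi>: "\<phi> \<in> grp_M" "map \<phi> (path [True, True] \<one>) = path [True, False] \<one>"
    using transitive_imp_map[of grp_M "[True, True]" "[True, False]"] by (auto simp: numeral_3_eq_3)
  then obtain x where x: "x \<in> N" "\<phi> = shift x \<or> \<phi> = shift x \<otimes>\<^bsub>Aut \<Gamma>\<^esub> sg" by (auto simp: grp_M_eq)
  from x(2) show False
  proof
    assume "\<phi> = shift x"
    then show False using \<phi> x shift_no_map[of x "[True]" "[False]" True] N_closed by simp
  next
    assume "\<phi> = shift x \<otimes>\<^bsub>Aut \<Gamma>\<^esub> sg"
    then have "path [False, True] (p \<otimes> x) = path [True, False] \<one>"
      using \<phi>(2) x(1) N_closed map_shift_sg_path[of \<one> x "[True, True]"] by simp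
    then have "p \<otimes> x = b" using path_alt_inj x(1) N_closed by simp
    moreover have "p \<otimes> x \<notin> N" using x(1) N_closed by simp
    ultimately show False by simp
  qed
qed

lemma shift_sg_no_map:
  assumes "x \<in> carrier X"
  shows "path [False, True, False] x \<noteq> path [True, True, False] \<one>"
proof
  assume eq: "path [False, True, False] x = path [True, True, False] \<one>"
  then have "path [True, False, True] (b \<otimes> x) = path [True, True, False] \<one>" using assms by (simp add: path_b)
  from path_inj(2)[OF _ _ _ this] assms show False by simp
qed

lemma map_grp_A: 
  assumes "\<phi> \<in> grp_A \<union> grp_P"
  obtains x where "x \<in> carrier X" "map \<phi> (path es \<one>) = path es x \<or> map \<phi> (path es \<one>) = path (alt True es) x"
proof -
  from assms obtain x where x: "x \<in> carrier X" "\<phi> = shift x \<or> \<phi> = shift x \<otimes>\<^bsub>Aut \<Gamma>\<^esub> sg \<or>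
      \<phi> = shift x \<otimes>\<^bsub>Aut \<Gamma>\<^esub> (sg \<otimes>\<^bsub>Aut \<Gamma>\<^esub> shift p)"
    by (auto simp: grp_A_eq grp_P_eq dest: N_closed)
  from x(2) show ?thesis
    by (elim disjE)
      (use x(1) that[of x] that[of "p \<otimes> x"] that[of "p \<otimes> (x \<otimes> p)"] in
        \<open>simp_all add: map_shift_path map_shift_sg_path map_shift_sg_shift_path\<close>)
qed

text \<open>Negation and alternation take (+,+,+) to only four of the eight sequences of three
  signs, and (+,+,-) is not one of them.\<close>

lemma grp_A_4: "\<not> arc_transitive \<Gamma> grp_A 4"
  and grp_P_4: "\<not> locally_arc_transitive \<Gamma> grp_P 4"
proof -
  have *: "\<not> (\<exists>\<phi>\<in>grp_A \<union> grp_P. map \<phi> (path [True, True, True] \<one>) = path [True, True, False] \<one>)"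
  proof
    assume "\<exists>\<phi>\<in>grp_A \<union> grp_P. map \<phi> (path [True, True, True] \<one>) = path [True, True, False] \<one>"
    then obtain \<phi> where \<phi>: "\<phi> \<in> grp_A \<union> grp_P"
      "map \<phi> (path [True, True, True] \<one>) = path [True, True, False] \<one>" by blast
    obtain x where x: "x \<in> carrier X"
      "path [True, True, True] x = path [True, True, False] \<one> \<or>
       path [False, True, False] x = path [True, True, False] \<one>"
      by (rule map_grp_A[OF \<phi>(1), of "[True, True, True]"]) (use \<phi>(2) in auto)
    then show False
      using path_inj(2)[of x \<one> "[True, True]" "[True, False]" True] shift_sg_no_map[of x] by auto
  qed
  then show "\<not> arc_transitive \<Gamma> grp_A 4" "\<not> locally_arc_transitive \<Gamma> grp_P 4"
    using transitive_imp_map[of grp_A "[True, True, True]" "[True, True, False]"]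
      transitive_imp_map[of grp_P "[True, True, True]" "[True, True, False]"]
    by (auto simp: eval_nat_numeral)
qed

end

section \<open>Polynomials over \<open>GF(2)\<close>\<close>

text \<open>A list of booleans stands for a polynomial over \<open>GF(2)\<close>, constant coefficient first.\<close>

fun ev :: "'a::field \<Rightarrow> bool list \<Rightarrow> 'a" where
  "ev x [] = 0"
| "ev x (c # cs) = of_bool c + x * ev x cs"

fun padd :: "bool list \<Rightarrow> bool list \<Rightarrow> bool list" where
  "padd [] q = q"
| "padd p [] = p"
| "padd (c # p) (d # q) = (c \<noteq> d) # padd p q"

fun trim :: "bool list \<Rightarrow> bool list" where
  "trim [] = []"
| "trim (c # p) = (let q = trim p in if q = [] \<and> \<not> c then [] else c # q)"

text \<open>Euclid's algorithm for polynomials with nonzero constant term. Since only roots \<open>x \<noteq> 0\<close> matter,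
  powers of \<open>x\<close> are divided out, which allows subtracting without shifting. The first
  argument bounds the number of steps; the junk value \<open>[]\<close> makes the checks below fail.\<close>

fun pgcd :: "nat \<Rightarrow> bool list \<Rightarrow> bool list \<Rightarrow> bool list" where
  "pgcd 0 p q = []"
| "pgcd (Suc k) p q =
    (if p = [] then q else if q = [] then p
     else let r = trim (dropWhile Not (padd p q)) in
       if length p \<le> length q then pgcd k p r else pgcd k r q)"

text \<open>The arguments are first brought into the form that \<open>pgcd\<close> expects, without
  factors x and without leading zeros. The 30 steps allowed are enough for the checks below to
  succeed.\<close>

definition pgcd3 :: "bool list \<Rightarrow> bool list \<Rightarrow> bool list \<Rightarrow> bool list" where
  "pgcd3 p q r = (let n = (\<lambda>p. trim (dropWhile Not p)) in pgcd 30 (n p) (pgcd 30 (n q) (n r)))"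

text \<open>The word \<open>a\<^sup>\<plusminus>\<^sup>1u\<^sub>\<alpha>a\<^sup>\<plusminus>\<^sup>1u\<^bsub>\<alpha>+1\<^esub>a\<^sup>\<plusminus>\<^sup>1u\<^sub>\<alpha> \<dots>\<close>, applied from left to right to a vector of homogeneous
  coordinates over \<open>GF(2)[\<alpha>]\<close>.\<close>

fun sym_image :: "bool \<Rightarrow> bool list \<Rightarrow> bool list \<times> bool list \<Rightarrow> bool list \<times> bool list" where
  "sym_image c [] v = v"
| "sym_image c (e # es) (X, Y) =
    (let (X', Y') = (if e then (padd X Y, X) else (Y, padd X Y));
         Z = False # Y'
     in sym_image (\<not> c) es (padd X' (if c then padd Z Y' else Z), Y'))"

text \<open>These are \<open>(x + 1)\<^sup>i\<close> for \<open>i = 0, 1, 3, 4, 7\<close> and \<open>(x\<^sup>2 + x + 1)\<^sup>2\<close>, the greatest common divisors that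
  occur; all their roots are in \<open>GF(4)\<close>.\<close>

definition units :: "bool list list" where
  "units = [[True], [True, True], [True, True, True, True], [True, False, False, False, True],
     [True, False, True, False, True], [True, True, True, True, True, True, True, True]]"

text \<open>The two cases: the word fixes \<open>\<infinity>\<close>, \<open>0\<close> and \<open>1\<close>, or it fixes \<open>\<infinity>\<close> and interchanges \<open>0\<close> and \<open>1\<close>.\<close>

definition sym_check :: "bool list \<Rightarrow> bool" where
  "sym_check es = (let (X, Y) = sym_image False es ([True], []);
      (X0, Y0) = sym_image False es ([], [True]);
      (X1, Y1) = sym_image False es ([True], [True])
    in pgcd3 Y X0 (padd X1 Y1) \<in> set units \<and> pgcd3 Y (padd X0 Y0) X1 \<in> set units)"

text \<open>All sign sequences are checked by evaluation. Closing words have even length, so a cycle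
  shorter than 10 leads to length 4, 6 or 8.\<close>

lemma sym_check_4: "list_all sym_check (List.n_lists 4 [True, False])"
  by code_simp

lemma sym_check_6: "list_all sym_check (List.n_lists 6 [True, False])"
  by code_simp

lemma sym_check_8: "list_all sym_check (List.n_lists 8 [True, False])"
  by code_simp

lemma sym_check: "length es \<in> {4, 6, 8} \<Longrightarrow> sym_check es"
proof -
  assume "length es \<in> {4, 6, 8}"
  moreover have "list_all sym_check (List.n_lists n [True, False]) \<Longrightarrow> length es = n \<Longrightarrow> sym_check es" for n
    by (auto simp: list_all_iff set_n_lists)
  ultimately show ?thesis
    using sym_check_4 sym_check_6 sym_check_8 by blast
qed

section \<open>Evaluation of the polynomials at \<alpha>\<close>

locale char_2 =
  fixes \<alpha> :: "'a::field"
  assumes two: "(1::'a) + 1 = 0"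
begin

lemma add_self [simp]: "(x::'a) + x = 0"
  by (metis distrib_left mult.right_neutral mult_zero_right two)

lemma add_self_left [simp]: "(x::'a) + (x + y) = y"
  by (simp flip: add.assoc)

lemma uminus_eq [simp]: "- (x::'a) = x"
  by (metis add_self add_eq_0_iff)

lemma minus_eq [simp]: "(x::'a) - y = x + y"
  by (metis diff_conv_add_uminus uminus_eq)

lemma add_eq_0_iff' [simp]: "(x::'a) + y = 0 \<longleftrightarrow> x = y"
  by (metis add_eq_0_iff uminus_eq)

lemma ev_padd: "ev (x::'a) (padd p q) = ev x p + ev x q"
  by (induction p q rule: padd.induct) (auto simp: algebra_simps)

lemma ev_trim: "ev (x::'a) (trim p) = ev x p"
  by (induction p) (auto simp: Let_def split: if_splits)

lemma ev_dropWhile: "(x::'a) \<noteq> 0 \<Longrightarrow> ev x (dropWhile Not p) = 0 \<longleftrightarrow> ev x p = 0"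
  by (induction p) auto

text \<open>A common nonzero root survives every step. It is also a root of the junk value, so the
  step bound calls for no termination argument.\<close>

lemma ev_pgcd: "(x::'a) \<noteq> 0 \<Longrightarrow> ev x p = 0 \<Longrightarrow> ev x q = 0 \<Longrightarrow> ev x (pgcd k p q) = 0"
  by (induction k p q rule: pgcd.induct) (auto simp: Let_def ev_trim ev_dropWhile ev_padd)

lemma ev_pgcd3:
  "(x::'a) \<noteq> 0 \<Longrightarrow> ev x p = 0 \<Longrightarrow> ev x q = 0 \<Longrightarrow> ev x r = 0 \<Longrightarrow> ev x (pgcd3 p q r) = 0"
  unfolding pgcd3_def Let_def by (intro ev_pgcd) (auto simp: ev_trim ev_dropWhile)

lemma ev_units:
  assumes "x ^ 4 \<noteq> (x::'a)" "p \<in> set units"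
  shows "ev x p \<noteq> 0"
proof -
  have "x ^ 4 + x = x * (x + 1) * (x * x + x + 1)"
    by (simp add: algebra_simps power4_eq_xxxx)
  with assms(1) have nz: "x + 1 \<noteq> 0" "x * x + x + 1 \<noteq> 0"
    by (metis add_eq_0_iff' mult_zero_left mult_zero_right)+
  have "ev x [True, True, True, True] = (x + 1) ^ 3"
    "ev x [True, False, False, False, True] = (x + 1) ^ 4"
    "ev x [True, False, True, False, True] = (x * x + x + 1) ^ 2"
    "ev x [True, True, True, True, True, True, True, True] = (x + 1) ^ 7"
    by (simp_all add: algebra_simps eval_nat_numeral)
  moreover have "ev x [True, True] = x + 1" by simp
  ultimately show ?thesis
    using assms(2) nz unfolding units_def by (auto simp del: ev.simps(2) add_eq_0_iff' simp: ev.simps(2)[of x True "[]"])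
qed

text \<open>The counterpart of \<open>sym_image\<close> with entries in the field. Evaluation at
  \<alpha> commutes with the two, so one finite check serves all fields of characteristic 2.\<close>

fun image :: "bool \<Rightarrow> bool list \<Rightarrow> 'a \<times> 'a \<Rightarrow> 'a \<times> 'a" where
  "image c [] v = v"
| "image c (e # es) (X, Y) =
    (let (X', Y') = (if e then (X + Y, X) else (Y, X + Y))
     in image (\<not> c) es (X' + (\<alpha> + of_bool c) * Y', Y'))"

lemma image_sym_image:
  "image c es (map_prod (ev \<alpha>) (ev \<alpha>) v) = map_prod (ev \<alpha>) (ev \<alpha>) (sym_image c es v)"
  by (induction c es v rule: sym_image.induct) (auto simp: Let_def ev_padd algebra_simps)

text \<open>Either configuration would make \<alpha> a common root of three polynomials, hence a
  root of their gcd. By \<open>sym_check\<close> and \<open>ev_units\<close> the latter has no root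
  outside GF(4).\<close>

lemma image_no_fix:
  assumes "\<alpha> ^ 4 \<noteq> \<alpha>" "length es \<in> {4, 6, 8}" "snd (image False es (1, 0)) = 0"
  shows "\<not> (fst (image False es (0, 1)) = 0 \<and> fst (image False es (1, 1)) = snd (image False es (1, 1)))"
    and "\<not> (fst (image False es (0, 1)) = snd (image False es (0, 1)) \<and> fst (image False es (1, 1)) = 0)"
proof -
  have nz: "\<alpha> \<noteq> 0" using assms(1) by auto
  obtain X Y X0 Y0 X1 Y1 where s: "sym_image False es ([True], []) = (X, Y)"
    "sym_image False es ([], [True]) = (X0, Y0)" "sym_image False es ([True], [True]) = (X1, Y1)"
    by (metis prod.exhaust)
  have e: "image False es (1, 0) = (ev \<alpha> X, ev \<alpha> Y)" "image False es (0, 1) = (ev \<alpha> X0, ev \<alpha> Y0)"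
    "image False es (1, 1) = (ev \<alpha> X1, ev \<alpha> Y1)"
    using image_sym_image[of False es "([True], [])"] image_sym_image[of False es "([], [True])"]
      image_sym_image[of False es "([True], [True])"] by (simp_all add: s)
  have "pgcd3 Y X0 (padd X1 Y1) \<in> set units" "pgcd3 Y (padd X0 Y0) X1 \<in> set units"
    using sym_check[OF assms(2)] by (simp_all add: sym_check_def s)
  then have u: "ev \<alpha> (pgcd3 Y X0 (padd X1 Y1)) \<noteq> 0" "ev \<alpha> (pgcd3 Y (padd X0 Y0) X1) \<noteq> 0"
    using ev_units[OF assms(1)] by auto
  show "\<not> (fst (image False es (0, 1)) = 0 \<and> fst (image False es (1, 1)) = snd (image False es (1, 1)))"
    using u(1) assms(3) ev_pgcd3[OF nz, of Y X0 "padd X1 Y1"] by (auto simp: e ev_padd)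
  show "\<not> (fst (image False es (0, 1)) = snd (image False es (0, 1)) \<and> fst (image False es (1, 1)) = 0)"
    using u(2) assms(3) ev_pgcd3[OF nz, of Y "padd X0 Y0" X1] by (auto simp: e ev_padd)
qed

end

section \<open>Connectedness and generation\<close>

context s3_amalgam
begin

text \<open>The cosets Yh with h in H include Y and are closed under adjacency, so by connectedness
  they are all the vertices. As Y lies in H, each such coset is contained in H.\<close>

lemma connected_imp_generated:
  assumes conn: "Digraph_Component.connected (with_proj \<Gamma>)"
    and H: "subgroup H X" "a \<in> H" "b \<in> H" "g \<in> H"
  shows "carrier X \<subseteq> H"
proof
  fix x assume x: "x \<in> carrier X"
  have YH: "Y \<subseteq> H" using H by (intro generate_subgroup_incl) auto
  have HX: "h \<in> H \<Longrightarrow> h \<in> carrier X" for h using H(1) by (rule subgroup.mem_carrier)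
  \<comment> \<open>Connectedness refers to the symmetric closure, so arcs have to be followed in
    both directions.\<close>
  let ?R = "parcs (mk_symmetric (with_proj \<Gamma>))"
  have "(Y #> \<one>, Y #> x) \<in> rtrancl_on (pverts \<Gamma>) ?R"
    using conn x by (auto simp: Digraph_Component.connected_def strongly_connected_def reachable_def pverts)
  then have "(Y #> \<one>, Y #> x) \<in> ?R\<^sup>*"
    by (rule rtrancl_on_rtranclI)
  then have "\<exists>h\<in>H. Y #> x = Y #> h"
  proof (induction rule: rtrancl_induct)
    case base
    then show ?case using subgroup.one_closed[OF H(1)] by blast
  next
    case (step v w)
    then obtain h where h: "h \<in> H" "v = Y #> h" by blast
    from step(2) consider "(v, w) \<in> parcs \<Gamma>" | "(w, v) \<in> parcs \<Gamma>"
      by (auto simp: parcs_mk_symmetric)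
    then show ?case
    proof cases
      case 1
      then obtain l where "l \<in> Y" "w = Y #> (g \<otimes> (l \<otimes> h))" using h HX by (auto simp: parcs_iff)
      moreover have "g \<otimes> (l \<otimes> h) \<in> H" using calculation YH h H by (auto intro!: subgroup.m_closed)
      ultimately show ?thesis by blast
    next
      case 2
      then obtain y where y: "y \<in> carrier X" "w = Y #> y"
        using parcs_subset by (auto simp: pverts)
      then obtain l where l: "l \<in> Y" "Y #> h = Y #> (g \<otimes> (l \<otimes> y))" using 2 h by (auto simp: parcs_iff)
      then obtain k where k: "k \<in> Y" "g \<otimes> (l \<otimes> y) = k \<otimes> h"
        using y HX[OF h(1)] by (auto simp: coset_eq_iff)
      then have "y = inv l \<otimes> (inv g \<otimes> (k \<otimes> h))"
        using y l HX[OF h(1)] by (simp add: inv_solve_left inv_solve_left')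
      moreover have "inv l \<otimes> (inv g \<otimes> (k \<otimes> h)) \<in> H"
        using YH h H k l by (auto intro!: subgroup.m_closed subgroup.m_inv_closed)
      ultimately show ?thesis using y by blast
    qed
  qed
  then obtain h k where "h \<in> H" "k \<in> Y" "x = k \<otimes> h"
    using x HX by (metis coset_eq_iff)
  then show "x \<in> H" using YH H(1) by (auto intro!: subgroup.m_closed)
qed

end

section \<open>Fractional linear maps\<close>

text \<open>In homogeneous coordinates fractional linear maps become linear (\<open>mob_pt\<close>),
  and the point at infinity needs no separate treatment.\<close>

definition pt :: "'a::field \<times> 'a \<Rightarrow> 'a option" where
  "pt v = (if snd v = 0 then None else Some (fst v / snd v))"

lemma pt_cases:
  obtains v where "z = pt v" "v \<noteq> (0, 0)"
proof (cases z)
  case None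
  then show ?thesis using that[of "(1, 0)"] by (simp add: pt_def)
next
  case (Some x)
  then show ?thesis using that[of "(x, 1)"] by (simp add: pt_def)
qed

lemma mob_pt:
  "(x, y) \<noteq> (0, 0) \<Longrightarrow> mob p q r s (pt (x, y)) = pt (p * x + q * y, r * x + s * y)"
proof (cases "y = 0")
  case False
  then have "p * (x / y) + q = (p * x + q * y) / y" "r * (x / y) + s = (r * x + s * y) / y"
    by (simp_all add: add_divide_distrib)
  with False show ?thesis by (simp add: mob_def pt_def)
qed (auto simp: mob_def pt_def)

lemma mob_vec_nonzero:
  fixes p q r s :: "'a::field"
  assumes "p * s - q * r \<noteq> 0" "(x, y) \<noteq> (0, 0)"
  shows "(p * x + q * y, r * x + s * y) \<noteq> (0, 0)"
proof
  assume "(p * x + q * y, r * x + s * y) = (0, 0)"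
  \<comment> \<open>The matrix is multiplied by its adjugate, which recovers the vector up to the
    determinant.\<close>
  moreover have "(p * s - q * r) * x = s * (p * x + q * y) - q * (r * x + s * y)"
    "(p * s - q * r) * y = p * (r * x + s * y) - r * (p * x + q * y)"
    by (simp_all add: algebra_simps)
  ultimately show False using assms by simp
qed

text \<open>This is the matrix product. The nonzero determinant keeps the intermediate vector
  nonzero, as \<open>mob_pt\<close> demands.\<close>

lemma mob_comp:
  fixes p q r s :: "'a::field"
  assumes "p * s - q * r \<noteq> 0"
  shows "mob p' q' r' s' \<circ> mob p q r s =
    mob (p' * p + q' * r) (p' * q + q' * s) (r' * p + s' * r) (r' * q + s' * s)"
proof
  fix z :: "'a option"
  obtain x y where z: "z = pt (x, y)" "(x, y) \<noteq> (0, 0)" by (metis pt_cases prod.exhaust)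
  show "(mob p' q' r' s' \<circ> mob p q r s) z =
      mob (p' * p + q' * r) (p' * q + q' * s) (r' * p + s' * r) (r' * q + s' * s) z"
    unfolding z(1) o_apply mob_pt[OF z(2)] mob_pt[OF mob_vec_nonzero[OF assms z(2)]]
    by (simp add: algebra_simps)
qed

lemma mob_scalar: "d \<noteq> 0 \<Longrightarrow> mob d 0 0 d = id"
  by (auto simp: mob_def fun_eq_iff split: option.splits)

lemma mob_in_T: "p * s - q * r \<noteq> 0 \<Longrightarrow> mob p q r s \<in> carrier T"
  by (auto simp: T_def)

lemma T_simps [simp]: "x \<otimes>\<^bsub>T\<^esub> y = y \<circ> x" "\<one>\<^bsub>T\<^esub> = id"
  by (simp_all add: T_def)

lemma T_group: "group (T :: ('a::field option \<Rightarrow> 'a option) monoid)"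
proof (rule groupI)
  fix x y :: "'a option \<Rightarrow> 'a option"
  assume "x \<in> carrier T" "y \<in> carrier T"
  then obtain p q r s p' q' r' s' where x: "x = mob p q r s" "p * s - q * r \<noteq> 0"
    and y: "y = mob p' q' r' s'" "p' * s' - q' * r' \<noteq> 0"
    by (auto simp: T_def)
  have "(p' * p + q' * r) * (r' * q + s' * s) - (p' * q + q' * s) * (r' * p + s' * r) =
    (p * s - q * r) * (p' * s' - q' * r')" by (simp add: algebra_simps)
  with x(2) y(2) have "y \<circ> x \<in> carrier T"
    unfolding x(1) y(1) mob_comp[OF x(2)] by (intro mob_in_T) simp
  then show "x \<otimes>\<^bsub>T\<^esub> y \<in> carrier T" by (simp add: T_def)
next
  show "\<one>\<^bsub>T\<^esub> \<in> carrier (T :: ('a option \<Rightarrow> 'a option) monoid)"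
    using mob_in_T[of 1 1 0 0] by (simp add: T_def mob_scalar)
next
  fix x :: "'a option \<Rightarrow> 'a option"
  assume "x \<in> carrier T"
  then obtain p q r s where x: "x = mob p q r s" "p * s - q * r \<noteq> 0" by (auto simp: T_def)
  \<comment> \<open>The adjugate gives the inverse, since the product is a scalar matrix.\<close>
  have "mob s (- q) (- r) p \<in> carrier T" using x(2) by (intro mob_in_T) (simp add: algebra_simps)
  moreover have "mob p q r s \<circ> mob s (- q) (- r) p = id"
    using x(2) by (subst mob_comp) (simp_all add: algebra_simps mob_scalar)
  ultimately show "\<exists>y\<in>carrier T. y \<otimes>\<^bsub>T\<^esub> x = \<one>\<^bsub>T\<^esub>"
    unfolding x(1) by auto
qed (auto simp: T_def o_assoc)

lemma G_simps [simp]: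
  "((x, y), e) \<otimes>\<^bsub>G\<^esub> ((x', y'), d) = ((if e then (y' \<circ> x, x' \<circ> y) else (x' \<circ> x, y' \<circ> y)), e \<noteq> d)"
  "\<one>\<^bsub>G\<^esub> = ((id, id), False)"
  "((x, y), e) \<in> carrier G \<longleftrightarrow> x \<in> carrier T \<and> y \<in> carrier T"
  by (auto simp: G_def T_def)

lemma T_closed [simp]:
  "id \<in> carrier T" "x \<in> carrier T \<Longrightarrow> y \<in> carrier T \<Longrightarrow> y \<circ> x \<in> carrier T"
  using monoid.one_closed[OF group.is_monoid[OF T_group]]
    monoid.m_closed[OF group.is_monoid[OF T_group], of x y] by simp_all

lemma T_inv:
  assumes "x \<in> carrier T"
  obtains y where "y \<in> carrier T" "y \<circ> x = id" "x \<circ> y = id"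
proof -
  interpret group T by (rule T_group)
  show ?thesis
    using inv_closed[OF assms] l_inv[OF assms] r_inv[OF assms] by (intro that) auto
qed

lemma G_group: "group (G :: 'a::field elt monoid)"
proof (rule groupI)
  fix x y z :: "'a elt"
  assume *: "x \<in> carrier G" "y \<in> carrier G"
  then show "x \<otimes>\<^bsub>G\<^esub> y \<in> carrier G"
    by (cases x; cases y; cases "fst x"; cases "fst y") auto
  show "x \<otimes>\<^bsub>G\<^esub> y \<otimes>\<^bsub>G\<^esub> z = x \<otimes>\<^bsub>G\<^esub> (y \<otimes>\<^bsub>G\<^esub> z)"
    by (cases x; cases y; cases z; cases "fst x"; cases "fst y"; cases "fst z") (auto simp: o_assoc)
next
  fix x :: "'a elt"
  assume "x \<in> carrier G"
  then obtain t u e where x: "x = ((t, u), e)" "t \<in> carrier T" "u \<in> carrier T"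
    by (cases x; cases "fst x") auto
  show "\<one>\<^bsub>G\<^esub> \<otimes>\<^bsub>G\<^esub> x = x" by (simp add: x)
  obtain t' u' where "t' \<in> carrier T" "t \<circ> t' = id" "u' \<in> carrier T" "u \<circ> u' = id"
    using x T_inv by metis
  then show "\<exists>y\<in>carrier G. y \<otimes>\<^bsub>G\<^esub> x = \<one>\<^bsub>G\<^esub>"
    by (intro bexI[of _ "((if e then u' else t', if e then t' else u'), e)"]) (auto simp: x)
qed simp

lemma gens_in_T [simp]:
  "ta \<in> carrier T" "tb \<in> carrier T" "tu t \<in> carrier T"
  by (auto simp: ta_def tb_def tu_def intro!: mob_in_T)

lemma Tsq_iff [simp]: "((x, y), e) \<in> Tsq \<longleftrightarrow> x \<in> carrier T \<and> y \<in> carrier T \<and> \<not> e"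
  by (auto simp: Tsq_def)

lemma Tsq_subgroup: "subgroup Tsq (G :: 'a::field elt monoid)"
proof (rule group.subgroupI[OF G_group])
  show "(Tsq :: 'a elt set) \<subseteq> carrier G" by (auto simp: Tsq_def G_def)
  show "(Tsq :: 'a elt set) \<noteq> {}" using Tsq_iff[of id id False] T_closed(1) by blast
next
  fix x :: "'a elt" assume "x \<in> Tsq"
  then obtain t u where x: "x = ((t, u), False)" "t \<in> carrier T" "u \<in> carrier T"
    by (cases x; cases "fst x") auto
  obtain t' u' where *: "t' \<in> carrier T" "t \<circ> t' = id" "u' \<in> carrier T" "u \<circ> u' = id"
    using x T_inv by metis
  then have "inv\<^bsub>G\<^esub> x = ((t', u'), False)"
    by (intro group.inv_equality[OF G_group]) (auto simp: x)
  then show "inv\<^bsub>G\<^esub> x \<in> Tsq" using * by simp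
next
  fix x y :: "'a elt" assume "x \<in> Tsq" "y \<in> Tsq"
  then show "x \<otimes>\<^bsub>G\<^esub> y \<in> Tsq"
    by (cases x; cases y; cases "fst x"; cases "fst y") auto
qed

lemma pi_elt_eq: "pi_elt = ((id, id), True)"
  by (simp add: pi_elt_def T_def)

lemma g_elt_eq: "g_elt t = ((tu t, tu t \<circ> tb), True)"
  by (simp add: g_elt_def pi_elt_eq T_def)

lemma L_diagonal: "generate G {((ta, ta), False), ((tb, tb), False)} \<subseteq> {((x, x), False) | x. True}"
proof
  let ?D = "{((x, x), False) | x. True}"
  fix l :: "'a elt"
  assume "l \<in> generate G {((ta, ta), False), ((tb, tb), False)}"
  then have "\<exists>x\<in>carrier T. l = ((x, x), False)"
  proof (induction rule: generate.induct)
    case (inv h)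
    then obtain x where x: "x \<in> carrier T" "h = ((x, x), False)" by auto
    obtain y where y: "y \<in> carrier T" "x \<circ> y = id" using T_inv x(1) by metis
    have "inv\<^bsub>G\<^esub> h = ((y, y), False)"
      using x y by (intro group.inv_equality[OF G_group]) auto
    with y show ?case by blast
  qed auto
  then show "l \<in> ?D" by blast
qed

section \<open>The amalgam inside the extension of T^2 by \<pi>\<close>

context char_2
begin

lemma two_eq_0 [simp]: "(2::'a) = 0"
  using two unfolding one_add_one .

lemma ta_ta: "ta \<circ> ta = mob 0 1 1 (1::'a)"
  by (simp add: ta_def mob_comp)

lemma ta_cubed: "ta \<circ> ta \<circ> ta = (id :: 'a option \<Rightarrow> 'a option)"
  unfolding ta_ta unfolding ta_def by (simp add: mob_comp mob_scalar)

lemma tb_tb: "tb \<circ> tb = (id :: 'a option \<Rightarrow> 'a option)"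
  by (simp add: tb_def mob_comp mob_scalar)

lemma ta_tb: "ta \<circ> tb = tb \<circ> ta \<circ> (ta :: 'a option \<Rightarrow> 'a option)"
  unfolding o_assoc[symmetric] ta_ta by (simp add: ta_def tb_def mob_comp)

lemma tu_tb: "tu t \<circ> tb = tu (t + 1 :: 'a)"
  by (simp add: tu_def tb_def mob_comp add.commute)

lemma tb_tu: "tb \<circ> tu t = tu (t + 1 :: 'a)"
  by (simp add: tu_def tb_def mob_comp)

lemma tu_tu: "tu s \<circ> tu t = tu (s + t :: 'a)"
  by (simp add: tu_def mob_comp add.commute)

lemma tu_0: "tu (0::'a) = id"
  by (simp add: tu_def mob_scalar)

lemma tu_None [simp]: "tu (t::'a) None = None" and tu_Some [simp]: "tu (t::'a) (Some x) = Some (x + t)"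
  by (simp_all add: tu_def mob_def)

lemma tu_1: "tu (1::'a) = tb"
  by (simp add: tb_def tu_def)

text \<open>The conjugate of a would have equal components x. At infinity, which \<open>tu\<close>
  fixes and \<open>ta\<close> sends to 1, the two components give x(\<infinity>) + \<alpha> = 1 and
  x(\<infinity>) + \<alpha> + 1 = 1.\<close>

lemma conj_not_diagonal:
  assumes "g_elt \<alpha> \<otimes>\<^bsub>G\<^esub> (((ta, ta), False) \<otimes>\<^bsub>G\<^esub> inv\<^bsub>G\<^esub> g_elt \<alpha>) = ((x, x), False)"
    and "x \<in> carrier T"
  shows False
proof -
  interpret group "G :: 'a elt monoid" by (rule G_group)
  have c: "g_elt \<alpha> \<in> carrier G" "((ta, ta), False) \<in> carrier (G :: 'a elt monoid)"
    "((x, x), False) \<in> carrier G"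
    using assms(2) by (auto simp: g_elt_eq)
  have "g_elt \<alpha> \<otimes>\<^bsub>G\<^esub> ((ta, ta), False) = ((x, x), False) \<otimes>\<^bsub>G\<^esub> g_elt \<alpha>"
    using c by (simp only: assms(1)[symmetric] m_assoc inv_closed m_closed l_inv r_one)
  then have 1: "ta \<circ> tu \<alpha> = tu \<alpha> \<circ> x" and 2: "ta \<circ> tu (\<alpha> + 1) = tu (\<alpha> + 1) \<circ> x"
    by (auto simp: g_elt_eq tu_tb)
  have "ta None = Some (1::'a)" by (simp add: ta_def mob_def)
  with fun_cong[OF 1, of None] fun_cong[OF 2, of None]
  have "tu \<alpha> (x None) = Some 1" "tu (\<alpha> + 1) (x None) = Some 1" by auto
  then show False by (cases "x None") (auto simp: add.assoc)
qed

sublocale amalgam: s3_amalgam_swap G "((ta, ta), False)" "((tb, tb), False)" "g_elt \<alpha>" pi_elt Tsq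
proof -
  interpret group "G :: 'a elt monoid" by (rule G_group)
  show "s3_amalgam_swap G ((ta, ta), False) ((tb, tb), False) (g_elt \<alpha>) pi_elt (Tsq :: 'a elt set)"
  proof (intro s3_amalgam_swap.intro s3_amalgam.intro s3_amalgam_axioms.intro s3_amalgam_swap_axioms.intro)
    show "g_elt \<alpha> \<otimes>\<^bsub>G\<^esub> (((ta, ta), False) \<otimes>\<^bsub>G\<^esub> inv\<^bsub>G\<^esub> g_elt \<alpha>)
        \<notin> generate G {((ta, ta), False), ((tb, tb), False)}"
    proof
      assume *: "g_elt \<alpha> \<otimes>\<^bsub>G\<^esub> (((ta, ta), False) \<otimes>\<^bsub>G\<^esub> inv\<^bsub>G\<^esub> g_elt \<alpha>)
        \<in> generate G {((ta, ta), False), ((tb, tb), False)}"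
      then obtain x where x: "g_elt \<alpha> \<otimes>\<^bsub>G\<^esub> (((ta, ta), False) \<otimes>\<^bsub>G\<^esub> inv\<^bsub>G\<^esub> g_elt \<alpha>) = ((x, x), False)"
        using L_diagonal by blast
      have "g_elt \<alpha> \<otimes>\<^bsub>G\<^esub> (((ta, ta), False) \<otimes>\<^bsub>G\<^esub> inv\<^bsub>G\<^esub> g_elt \<alpha>) \<in> carrier G"
        by (intro m_closed inv_closed) (simp_all add: g_elt_eq)
      with x conj_not_diagonal[OF x] show False by simp
    qed
    fix x y :: "'a elt"
    assume "x \<in> carrier G" "y \<in> carrier G" "x \<notin> Tsq" "y \<notin> Tsq"
    then show "x \<otimes>\<^bsub>G\<^esub> y \<in> Tsq"
      by (cases x; cases y; cases "fst x"; cases "fst y") auto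
  qed (use ta_cubed in \<open>auto simp: g_elt_eq pi_elt_eq tb_tb ta_tb tu_tb tb_tu tu_tu tu_0 tu_1
      G_group Tsq_subgroup add.assoc o_assoc\<close>)
qed

text \<open>The components of a word in \<open>G\<close>: every factor \<open>g\<^sub>\<alpha>\<close> contains \<open>\<pi>\<close> and hence interchanges the roles of
  \<open>u\<^sub>\<alpha>\<close> and \<open>bu\<^sub>\<alpha> = u\<^bsub>\<alpha>+1\<^esub>\<close>.\<close>

fun tw :: "bool \<Rightarrow> bool list \<Rightarrow> 'a option \<Rightarrow> 'a option" where
  "tw c [] = id"
| "tw c (e # es) = tw (\<not> c) es \<circ> (tu (\<alpha> + of_bool c) \<circ> (if e then ta else ta \<circ> ta))"

text \<open>The last component is the parity of the number of factors \<pi>; it forces closing words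
  to have even length.\<close>

lemma word_eq: "amalgam.word es = ((tw False es, tw True es), odd (length es))"
proof (induction es)
  case (Cons e es)
  show ?case
    unfolding amalgam.word.simps Cons.IH by (simp add: amalgam.rot_def g_elt_eq tu_tb fun_eq_iff)
qed (simp only: amalgam.word.simps, simp add: id_def)

lemma tw_pt:
  "v \<noteq> (0, 0) \<Longrightarrow> tw c es (pt v) = pt (image c es v)"
proof (induction c es v rule: image.induct)
  case (2 c e es X Y)
  define V where "V = (if e then (X + Y, X) else (Y, X + Y))"
  have V: "V \<noteq> (0, 0)" "(if e then ta else ta \<circ> ta) (pt (X, Y)) = pt V"
    using 2(2) unfolding V_def ta_ta by (auto simp: ta_def mob_pt)
  obtain V1 V2 where V12: "V = (V1, V2)" by fastforce
  define W where "W = (V1 + (\<alpha> + of_bool c) * V2, V2)"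
  have W: "W \<noteq> (0, 0)" "tu (\<alpha> + of_bool c) (pt V) = pt W"
    using V(1) by (auto simp: V12 W_def tu_def mob_pt)
  have step: "image c (e # es) (X, Y) = image (\<not> c) es W"
    using V12 by (simp add: V_def W_def split: if_splits)
  have "tw (\<not> c) es (pt W) = image_pt"
    if "image_pt = pt (image (\<not> c) es W)" for image_pt
    using 2(1)[OF V12[unfolded V_def, symmetric] ] W(1) that by (simp add: W_def)
  then show ?case using step V(2) W(2) by simp
qed simp

text \<open>The first component alone suffices: being 1 or b, it would fix infinity and either fix
  or interchange 0 and 1.\<close>

lemma word_notin:
  assumes "\<alpha> ^ 4 \<noteq> \<alpha>" "length es \<in> {4, 6, 8}"
  shows "amalgam.word es \<notin> {\<one>\<^bsub>G\<^esub>, ((tb, tb), False)}"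
proof
  let ?f = "image False es"
  assume "amalgam.word es \<in> {\<one>\<^bsub>G\<^esub>, ((tb, tb), False)}"
  then consider "tw False es = id" | "tw False es = tb" by (auto simp: word_eq)
  then show False
  proof cases
    case 1
    then have "pt (?f (1, 0)) = None" "pt (?f (0, 1)) = Some 0" "pt (?f (1, 1)) = Some 1"
      by (simp_all flip: tw_pt) (simp_all add: pt_def)
    then show False using image_no_fix(1)[OF assms] by (auto simp: pt_def split: if_splits)
  next
    case 2
    then have "pt (?f (1, 0)) = None" "pt (?f (0, 1)) = Some 1" "pt (?f (1, 1)) = Some 0"
      by (simp_all flip: tw_pt) (simp_all add: pt_def tb_def mob_def)
    then show False using image_no_fix(2)[OF assms] by (auto simp: pt_def split: if_splits)
  qed
qed

abbreviation "\<Gamma> \<equiv> Gam \<alpha>"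

lemma Gam_eq: "\<Gamma> = coset_graph G (generate G {((ta, ta), False), ((tb, tb), False)})
    (double_coset G (generate G {((ta, ta), False), ((tb, tb), False)}) (g_elt \<alpha>))"
  by (simp add: Gam_def L_def)

lemma girth_ge_10:
  assumes "\<alpha> ^ 4 \<noteq> \<alpha>"
  shows "10 \<le> girth \<Gamma>"
  unfolding girth_def
proof (rule INF_greatest)
  fix p assume "p \<in> {p. pre_digraph.cycle (with_proj \<Gamma>) p \<and> 3 \<le> length p}"
  then obtain es where es: "length es = length p" "amalgam.word es \<in> {\<one>\<^bsub>G\<^esub>, ((tb, tb), False)}"
    and p: "3 \<le> length p"
    using amalgam.cycle_word unfolding Gam_eq by blast
  then have "even (length p)" by (auto simp: word_eq)
  moreover have "length p \<notin> {4, 6, 8}" using word_notin[OF assms] es by metis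
  ultimately have "10 \<le> length p" using p by (auto elim!: evenE)
  then show "10 \<le> enat (length p)" by (metis enat_ord_simps(1) numeral_eq_enat)
qed

lemma frobenius_add: "(x + y) ^ 4 = x ^ 4 + (y::'a) ^ 4"
proof -
  have "(x + y) ^ 4 = ((x + y) ^ 2) ^ 2" by (simp flip: power_mult)
  also have "\<dots> = x ^ 4 + y ^ 4" by (simp add: power2_sum flip: power_mult)
  finally show ?thesis .
qed

lemma frobenius_pt: "map_option (\<lambda>x. x ^ 4) (pt (x, y)) = pt (x ^ 4, (y::'a) ^ 4)"
  by (simp add: pt_def power_divide)

lemma frobenius_mob:
  assumes "p ^ 4 = p" "q ^ 4 = q" "r ^ 4 = r" "s ^ 4 = (s::'a)"
  shows "map_option (\<lambda>x. x ^ 4) \<circ> mob p q r s = mob p q r s \<circ> map_option (\<lambda>x. x ^ 4)"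
proof
  fix z :: "'a option"
  obtain x y where z: "z = pt (x, y)" "(x, y) \<noteq> (0, 0)" by (metis pt_cases prod.exhaust)
  then have "(x ^ 4, y ^ 4) \<noteq> (0, 0)" by simp
  then show "(map_option (\<lambda>x. x ^ 4) \<circ> mob p q r s) z = (mob p q r s \<circ> map_option (\<lambda>x. x ^ 4)) z"
    using z by (simp add: mob_pt frobenius_pt frobenius_add power_mult_distrib assms del: map_option_eq_Some)
qed

text \<open>If \<alpha> is fixed by x \<mapsto> x^4, then all generators have components commuting
  with this map. The elements with such components form a subgroup, which by connectedness is the
  whole group.\<close>

lemma connected_imp_frobenius_trivial:
  assumes "Digraph_Component.connected (with_proj \<Gamma>)" "\<alpha> ^ 4 = \<alpha>"
  shows "(x::'a) ^ 4 = x"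
proof -
  define \<psi> :: "'a option \<Rightarrow> 'a option" where "\<psi> = map_option (\<lambda>x. x ^ 4)"
  define H :: "'a elt set" where
    "H = {((x, y), e) | x y e. x \<in> carrier T \<and> y \<in> carrier T \<and> \<psi> \<circ> x = x \<circ> \<psi> \<and> \<psi> \<circ> y = y \<circ> \<psi>}"
  have comp: "\<psi> \<circ> (y \<circ> x) = (y \<circ> x) \<circ> \<psi>" if "\<psi> \<circ> x = x \<circ> \<psi>" "\<psi> \<circ> y = y \<circ> \<psi>" for x y
    using that by (metis o_assoc)
  have inv: "\<psi> \<circ> y = y \<circ> \<psi>" if "\<psi> \<circ> x = x \<circ> \<psi>" "y \<circ> x = id" "x \<circ> y = id" for x y
    using that by (metis o_assoc comp_id id_comp)
  have gens: "\<psi> \<circ> ta = ta \<circ> \<psi>" "\<psi> \<circ> tb = tb \<circ> \<psi>" "\<psi> \<circ> tu \<alpha> = tu \<alpha> \<circ> \<psi>"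
    unfolding ta_def tb_def tu_def \<psi>_def using assms(2) by (simp_all add: frobenius_mob)
  have "subgroup H G"
  proof (rule amalgam.subgroupI)
    show "H \<subseteq> carrier G" by (auto simp: H_def)
    have "((id, id), False) \<in> H" by (auto simp: H_def)
    then show "H \<noteq> {}" by blast
  next
    fix h assume "h \<in> H"
    then obtain x y e where h: "h = ((x, y), e)" "x \<in> carrier T" "y \<in> carrier T"
      "\<psi> \<circ> x = x \<circ> \<psi>" "\<psi> \<circ> y = y \<circ> \<psi>" by (auto simp: H_def)
    obtain x' where x': "x' \<in> carrier T" "x' \<circ> x = id" "x \<circ> x' = id" using T_inv h(2) by metis
    obtain y' where y': "y' \<in> carrier T" "y' \<circ> y = id" "y \<circ> y' = id" using T_inv h(3) by metis
    have "inv\<^bsub>G\<^esub> h = ((if e then y' else x', if e then x' else y'), e)"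
      using h x' y' by (intro amalgam.inv_equality) auto
    then show "inv\<^bsub>G\<^esub> h \<in> H"
      using x' y' inv[OF h(4) x'(2,3)] inv[OF h(5) y'(2,3)] by (auto simp: H_def)
  next
    fix h k assume "h \<in> H" "k \<in> H"
    then show "h \<otimes>\<^bsub>G\<^esub> k \<in> H" by (auto simp: H_def comp)
  qed
  then have "carrier G \<subseteq> H"
    using assms(1) gens unfolding Gam_eq
    by (intro amalgam.connected_imp_generated) (auto simp: H_def g_elt_eq comp)
  moreover have "((tu x, id), False) \<in> carrier G" by simp
  ultimately have "((tu x, id), False) \<in> H" by blast
  then have "\<psi> \<circ> tu x = tu x \<circ> \<psi>" by (simp add: H_def)
  \<comment> \<open>At the point 0 the two sides are x^4 and x.\<close>
  from fun_cong[OF this, of "Some 0"] show ?thesis by (simp add: \<psi>_def)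
qed

lemma rmul_eq: "rmul = amalgam.shift" and sig_eq: "sig = amalgam.sg"
  by (auto simp: fun_eq_iff rmul_def amalgam.shift_def sig_def amalgam.sg_def L_def)

lemma grp_eqs:
  "grpG = amalgam.grp_G" "grpGplus = amalgam.grp_N" "grpA \<alpha> = amalgam.grp_A"
  "grpM \<alpha> = amalgam.grp_M" "grpAplus \<alpha> = amalgam.grp_P"
  by (simp_all add: grpG_def grpGplus_def grpA_def grpM_def grpAplus_def rmul_eq sig_eq Gam_eq
      amalgam.grp_G_def amalgam.grp_N_def amalgam.grp_A_def amalgam.grp_M_def amalgam.grp_P_def)

end

lemma char_2_if_card:
  assumes "CARD('a) = 2 ^ f"
  shows "(1::'a::{field, finite}) + 1 = 0"
proof -
  have "(of_nat (2 ^ f) :: 'a) = 0"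
    using CHAR_dvd_CARD[where 'a = 'a] assms by (simp only: of_nat_eq_0_iff_char_dvd)
  then show ?thesis by simp
qed

text \<open>The nonzero polynomial X^4 - X has at most four roots.\<close>

lemma card_le_4_if_frobenius_trivial:
  assumes "\<And>x::'a::{field, finite}. x ^ 4 = x"
  shows "CARD('a) \<le> 4"
proof -
  define P where "P = Polynomial.monom 1 4 - Polynomial.monom (1::'a) 1"
  have "Polynomial.coeff P 4 = 1" by (simp add: P_def)
  then have nz: "P \<noteq> 0" by auto
  have "Polynomial.degree P \<le> 4" unfolding P_def by (intro degree_diff_le) (simp_all add: Polynomial.degree_monom_eq)
  moreover have "{x. poly P x = 0} = UNIV" using assms by (simp add: P_def poly_monom)
  ultimately show ?thesis using card_poly_roots_bound[OF nz] by simp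
qed

theorem proposition9p2:
  fixes f :: nat and \<alpha> :: "'a :: {field, finite}"
  assumes "f \<ge> 3" and "CARD('a) = 2 ^ f"
    and "Digraph_Component.connected (with_proj (Gam \<alpha>))"
  shows
    "girth (Gam \<alpha>) \<ge> 10 \<and>
     (arc_transitive (Gam \<alpha>) (grpA \<alpha>) 3 \<and> \<not> arc_transitive (Gam \<alpha>) (grpA \<alpha>) 4) \<and>
     (locally_arc_transitive (Gam \<alpha>) (grpAplus \<alpha>) 3 \<and>
       \<not> locally_arc_transitive (Gam \<alpha>) (grpAplus \<alpha>) 4) \<and>
     (arc_transitive (Gam \<alpha>) grpG 2 \<and> \<not> arc_transitive (Gam \<alpha>) grpG 3) \<and>
     (arc_transitive (Gam \<alpha>) (grpM \<alpha>) 2 \<and> \<not> arc_transitive (Gam \<alpha>) (grpM \<alpha>) 3) \<and>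
     (locally_arc_transitive (Gam \<alpha>) grpGplus 2 \<and> \<not> locally_arc_transitive (Gam \<alpha>) grpGplus 3)"
proof -
  interpret char_2 \<alpha>
    using char_2_if_card[OF assms(2)] by unfold_locales
  \<comment> \<open>Otherwise the field would have at most 4 elements, but f \<ge> 3 gives at least
    8.\<close>
  have "\<alpha> ^ 4 \<noteq> \<alpha>"
  proof
    assume "\<alpha> ^ 4 = \<alpha>"
    then have "CARD('a) \<le> 4"
      using connected_imp_frobenius_trivial[OF assms(3)] card_le_4_if_frobenius_trivial by blast
    moreover have "(2::nat) ^ 3 \<le> 2 ^ f" using assms(1) by (intro power_increasing) auto
    ultimately show False using assms(2) by simp
  qed
  then have "10 \<le> girth (Gam \<alpha>)" by (rule girth_ge_10)
  then show ?thesis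
    unfolding grp_eqs unfolding Gam_eq
    using amalgam.grp_A_3 amalgam.grp_A_4 amalgam.grp_P_3 amalgam.grp_P_4 amalgam.grp_G_2
      amalgam.grp_G_3 amalgam.grp_M_2 amalgam.grp_M_3 amalgam.grp_N_2 amalgam.grp_N_3
    by blast
qed

end
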